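(* For every integer $n\ge0$, every $i\in\{0,2\}$ and every $k\in\{0,1,2,3,4\}$, the number of partitions $\pi$ of $5n+4$ with $\mathrm{srank}(\pi)\equiv i\pmod 4$ and $\mathrm{St\text{-}crank}(\pi)\equiv k\pmod 5$ equals $\tfrac15 p_i(5n+4)$. In other words, the residue of the St-crank mod $5$ divides the partitions enumerated by $p_i(5n+4)$ into five equinumerous classes.
   Context: Partitions are written $\pi=(\lambda_1\ge\lambda_2\ge\cdots)$; $|\pi|$ is the sum of parts, $\pi'$ the conjugate, $f_k$ the number of parts equal to $k$. $\mathcal O(\pi)$ is the number of odd parts, $\mathrm{srank}(\pi)=\mathcal O(\pi)-\mathcal O(\pi')$ (always even), and $p_i(n)$ ($i=0,2$) is the number of partitions of $n$ with $\mathrm{srank}\equiv i\pmod 4$. Andrews–Garvan crank: with $\ell(\pi)$ the largest part ($0$ if empty), $\mu(\pi)$ the number of parts equal to $1$, $\tilde\nu(\pi)$ the number of parts larger than $\mu(\pi)$: $\mathrm{crank}(\pi)=\ell(\pi)$ if $\mu(\pi)=0$, and $\tilde\nu(\pi)-\mu(\pi)$ otherwise. For a partition $\pi$ let $\pi_1$ be the partition in which each $k\ge1$ occurs $\lfloor f_{2k}(\pi)/2\rfloor$ times. Type B: $\pi=(\lambda_1,\lambda_2,\dots)$ with conjugate $(\lambda_1',\lambda_2',\dots)$ is of type B iff either $\pi=(3,1)$, or: $|\pi|\ne4$, $\lambda_1-\lambda_2\ge2$, $\lambda_1'-\lambda_2'\ge2$, it is not the case that $\lambda_1-2$ and $\lambda_2$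 are equal even integers, and $\pi$ has no repeated even parts. $\Psi(\pi)=1$ if $\pi$ is of type B, else $0$. $\mathrm{St\text{-}crank}(\pi)=\mathrm{crank}(\pi_1)+\tfrac12\mathrm{srank}(\pi)+\Psi(\pi)$. *)

theory Defs
  imports Complex_Main
begin

definition is_partition :: "nat list \<Rightarrow> bool" where
  "is_partition xs \<longleftrightarrow> sorted_wrt (\<lambda>a b. b \<le> a) xs \<and> (\<forall>x\<in>set xs. 0 < x)"

definition partitions :: "nat \<Rightarrow> nat list set" where
  "partitions n = {xs. is_partition xs \<and> sum_list xs = n}"

definition part :: "nat list \<Rightarrow> nat \<Rightarrow> nat" where
  "part xs j = (if 1 \<le> j \<and> j \<le> length xs then xs ! (j - 1) else 0)"

definition largest :: "nat list \<Rightarrow> nat" where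
  "largest xs = fold max xs 0"

definition conj :: "nat list \<Rightarrow> nat list" where
  "conj xs = map (\<lambda>j. length (filter (\<lambda>x. j \<le> x) xs)) [1..<Suc (largest xs)]"

definition odd_parts :: "nat list \<Rightarrow> nat" where
  "odd_parts xs = length (filter odd xs)"

definition srank :: "nat list \<Rightarrow> int" where
  "srank xs = int (odd_parts xs) - int (odd_parts (conj xs))"

definition crank :: "nat list \<Rightarrow> int" where
  "crank xs = (if count_list xs 1 = 0 then int (largest xs)
     else int (length (filter (\<lambda>x. count_list xs 1 < x) xs)) - int (count_list xs 1))"

definition pi1 :: "nat list \<Rightarrow> nat list" where
  "pi1 xs = concat (map (\<lambda>k. replicate (count_list xs (2 * k) div 2) k)
                        (rev [1..<Suc (largest xs)]))"

definition typeB :: "nat list \<Rightarrow> bool" where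
  "typeB xs \<longleftrightarrow> xs = [3, 1] \<or>
     (sum_list xs \<noteq> 4
      \<and> int (part xs 1) - int (part xs 2) \<ge> 2
      \<and> int (part (conj xs) 1) - int (part (conj xs) 2) \<ge> 2
      \<and> \<not> (int (part xs 1) - 2 = int (part xs 2) \<and> even (part xs 2))
      \<and> (\<forall>k. even k \<longrightarrow> count_list xs k \<le> 1))"

definition Psi :: "nat list \<Rightarrow> int" where
  "Psi xs = (if typeB xs then 1 else 0)"

definition stcrank :: "nat list \<Rightarrow> int" where
  "stcrank xs = crank (pi1 xs) + srank xs div 2 + Psi xs"

definition p_srank :: "nat \<Rightarrow> nat \<Rightarrow> nat" where
  "p_srank i m = card {xs \<in> partitions m. srank xs mod 4 = int i}"

end

theory Submission
  imports Defs "HOL-Computational_Algebra.Formal_Power_Series"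
begin

text \<open>
  Removing pairs of equal even parts splits a partition into \<open>\<pi>\<^sub>1\<close> and a partition without repeated
  even parts, without changing the srank. Hence, with \<open>x\<close> marking the St-crank and a sign \<open>\<epsilon>\<close> marking
  the parity of half the srank, the generating function is the product of the crank generating function
  in \<open>q\<^sup>4\<close> and the srank generating function; the latter is an infinite product by Boulet's
  decomposition. The combinatorial crank fails to be given by its infinite product only for the partition (1);
  the partitions of type B are the partitions without repeated even parts enlarged by a hook of
  size 4, so \<open>\<Psi>\<close> repairs precisely this defect. With \<open>Q = \<epsilon> q\<^sup>2\<close> the result is
  \<open>(q\<^sup>4; q\<^sup>4) (-q; q\<^sup>2) / ((xQ; Q) (x\<^sup>-\<^sup>1Q; Q))\<close>.
  If \<open>x\<close> is a primitive fifth root of unity, multiplying numerator and denominator by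
  \<open>(Q; Q) (x\<^sup>2Q; Q) (x\<^sup>-\<^sup>2Q; Q)\<close> makes the denominator a series in \<open>q\<^sup>5\<close>, and by the Jacobi triple
  product the numerator has exponents \<open>k(k+1)/2 + m(m+1)\<close> with \<open>m\<close> not congruent to 2 modulo 5,
  none of which is congruent to 4 modulo 5.
\<close>

unbundle fps_syntax

section \<open>Infinite products of formal power series\<close>

text \<open>Half the srank enters the St-crank because two products interlace: it puts
  \<open>x\<close> times the sign into the srank product, whose factors then sit at the odd powers
  of Q, while the crank of \<open>pi1\<close> supplies the factors at the even powers. The signs 1
  and -1 separate the srank classes modulo 4, and their square being 1 gives Q^2 = q^4, on which the
  interlacing rests. The crank product has the coefficient x - 1 + x^-1 at q, where the partition
  (1) contributes only x^-1. One part 1 of \<open>pi1\<close> stands for four cells, so the defect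
  is (x - 1) q^4 times the series of the partitions without repeated even parts. This asks for a
  hook of size 4 that preserves the srank and leaves \<open>pi1\<close> empty. Infinite denominators
  are kept multiplied out. The final residue argument divides only by a series in q^5, and does so
  by induction on the exponent. Equal classes modulo 5 amount to vanishing weighted sums at every
  nontrivial fifth root of unity.\<close>

lemma eventually_fps_nth_eq_upto:
  fixes f :: "nat \<Rightarrow> 'a :: group_add fps"
  assumes "f \<longlonglongrightarrow> a"
  shows "\<forall>\<^sub>F N in sequentially. \<forall>k\<le>n. f N $ k = a $ k"
proof -
  have "\<forall>\<^sub>F N in sequentially. \<forall>k\<in>{..n}. f N $ k = a $ k"
    using assms by (subst eventually_ball_finite_distrib) (auto simp: tendsto_fps_iff)
  then show ?thesis
    by eventually_elim auto
qed

lemma tendsto_mult_fps: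
  fixes f g :: "nat \<Rightarrow> 'a :: comm_ring_1 fps"
  assumes "f \<longlonglongrightarrow> a" "g \<longlonglongrightarrow> b"
  shows "(\<lambda>N. f N * g N) \<longlonglongrightarrow> a * b"
proof (rule tendsto_fpsI)
  fix n
  from eventually_fps_nth_eq_upto[OF assms(1), of n] eventually_fps_nth_eq_upto[OF assms(2), of n]
  show "\<forall>\<^sub>F N in sequentially. (f N * g N) $ n = (a * b) $ n"
    by eventually_elim (simp add: fps_mult_nth)
qed

lemma tendsto_add_fps:
  fixes f g :: "nat \<Rightarrow> 'a :: comm_ring_1 fps"
  assumes "f \<longlonglongrightarrow> a" "g \<longlonglongrightarrow> b"
  shows "(\<lambda>N. f N + g N) \<longlonglongrightarrow> a + b"
proof (rule tendsto_fpsI)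
  fix n
  have "\<forall>\<^sub>F N in sequentially. f N $ n = a $ n" "\<forall>\<^sub>F N in sequentially. g N $ n = b $ n"
    using assms by (simp_all add: tendsto_fps_iff)
  then show "\<forall>\<^sub>F N in sequentially. (f N + g N) $ n = (a + b) $ n"
    by eventually_elim simp
qed

lemma tendsto_diff_fps:
  fixes f g :: "nat \<Rightarrow> 'a :: comm_ring_1 fps"
  assumes "f \<longlonglongrightarrow> a" "g \<longlonglongrightarrow> b"
  shows "(\<lambda>N. f N - g N) \<longlonglongrightarrow> a - b"
proof (rule tendsto_fpsI)
  fix n
  have "\<forall>\<^sub>F N in sequentially. f N $ n = a $ n" "\<forall>\<^sub>F N in sequentially. g N $ n = b $ n"
    using assms by (simp_all add: tendsto_fps_iff)
  then show "\<forall>\<^sub>F N in sequentially. (f N - g N) $ n = (a - b) $ n"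
    by eventually_elim simp
qed

lemma fps_mult_power_nth_eq_0:
  fixes f q :: "'a :: comm_ring_1 fps"
  assumes "q $ 0 = 0" "n < N"
  shows "(f * q ^ N) $ n = 0"
  using startsby_zero_power_prefix[OF assms(1), of N] assms(2)
  by (auto simp: fps_mult_nth intro!: sum.neutral)

definition qpoch :: "'a :: comm_ring_1 \<Rightarrow> 'a \<Rightarrow> nat \<Rightarrow> 'a" where
  "qpoch a q n = (\<Prod>k<n. 1 - a * q ^ k)"

text \<open>For \<^term>\<open>q $ 0 = 0\<close> the factors with index above \<^term>\<open>n\<close> do not affect the
  \<^term>\<open>n\<close>-th coefficient, so this is the infinite product.\<close>

definition qinf :: "'a :: comm_ring_1 fps \<Rightarrow> 'a fps \<Rightarrow> 'a fps" where
  "qinf a q = Abs_fps (\<lambda>n. qpoch a q (Suc n) $ n)"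

lemma qpoch_0 [simp]: "qpoch a q 0 = 1"
  by (simp add: qpoch_def)

lemma qpoch_Suc: "qpoch a q (Suc n) = qpoch a q n * (1 - a * q ^ n)"
  by (simp add: qpoch_def)

lemma qpoch_Suc_shift: "qpoch a q (Suc n) = (1 - a) * qpoch (a * q) q n"
  unfolding qpoch_def by (subst prod.lessThan_Suc_shift) (simp add: mult.assoc)

lemma qpoch_tendsto_qinf:
  assumes "q $ 0 = 0"
  shows "qpoch a q \<longlonglongrightarrow> qinf a q"
proof (rule tendsto_fpsI)
  fix n
  have "qpoch a q N $ n = qpoch a q (Suc n) $ n" if "N \<ge> Suc n" for N
    using that
  proof (induction rule: dec_induct)
    case (step N)
    have "qpoch a q (Suc N) $ n = qpoch a q N $ n - (qpoch a q N * a * q ^ N) $ n"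
      by (simp add: qpoch_Suc algebra_simps)
    then show ?case
      using step fps_mult_power_nth_eq_0[OF assms, of n N "qpoch a q N * a"] by simp
  qed simp
  then show "\<forall>\<^sub>F N in sequentially. qpoch a q N $ n = qinf a q $ n"
    unfolding qinf_def fps_nth_Abs_fps eventually_sequentially by blast
qed

lemma qpoch_tendsto_qinf':
  assumes "q $ 0 = 0" "filterlim h at_top sequentially"
  shows "(\<lambda>N. qpoch a q (h N)) \<longlonglongrightarrow> qinf a q"
  using filterlim_compose[OF qpoch_tendsto_qinf[OF assms(1)] assms(2)] .

lemma qinf_shift:
  assumes "q $ 0 = 0"
  shows "qinf a q = (1 - a) * qinf (a * q) q"
proof (rule LIMSEQ_unique)
  show "(\<lambda>N. qpoch a q (Suc N)) \<longlonglongrightarrow> qinf a q"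
    by (rule qpoch_tendsto_qinf'[OF assms filterlim_Suc])
  show "(\<lambda>N. qpoch a q (Suc N)) \<longlonglongrightarrow> (1 - a) * qinf (a * q) q"
    unfolding qpoch_Suc_shift by (intro tendsto_mult_fps tendsto_const qpoch_tendsto_qinf assms)
qed

lemma qinf_qpoch_mult:
  assumes "q $ 0 = 0"
  shows "qinf a q = qpoch a q m * qinf (a * q ^ m) q"
proof (induction m)
  case (Suc m)
  then show ?case
    using qinf_shift[OF assms, of "a * q ^ m"] by (simp add: qpoch_Suc mult_ac)
qed simp

lemma qinf_even_odd:
  assumes "q $ 0 = 0"
  shows "qinf a q = qinf a (q\<^sup>2) * qinf (a * q) (q\<^sup>2)"
proof (rule LIMSEQ_unique)
  have q2: "q\<^sup>2 $ 0 = 0"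
    using assms by (simp add: power2_eq_square)
  have *: "qpoch a q (2 * N) = qpoch a (q\<^sup>2) N * qpoch (a * q) (q\<^sup>2) N" for N
    by (induction N) (simp_all add: qpoch_Suc power_mult[symmetric] mult_ac power_add)
  show "(\<lambda>N. qpoch a q (2 * N)) \<longlonglongrightarrow> qinf a q"
    by (rule qpoch_tendsto_qinf'[OF assms mult_nat_left_at_top]) simp
  show "(\<lambda>N. qpoch a q (2 * N)) \<longlonglongrightarrow> qinf a (q\<^sup>2) * qinf (a * q) (q\<^sup>2)"
    unfolding * by (intro tendsto_mult_fps qpoch_tendsto_qinf q2)
qed

lemma qinf_nth_0 [simp]: "qinf a q $ 0 = 1 - a $ 0"
  by (simp add: qinf_def qpoch_def)

lemma qpoch_nth_0: "a $ 0 = 0 \<Longrightarrow> qpoch a q n $ 0 = 1"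
  by (induction n) (simp_all add: qpoch_Suc)

text \<open>Factor by factor this is the splitting of 1 - y^5. The hypothesis makes \<open>c\<close>
  a root of the fifth cyclotomic polynomial; the proof uses ring identities only, since no integral
  domain is assumed.\<close>

lemma qinf_fifth_roots:
  fixes c q :: "'a :: comm_ring_1 fps"
  assumes q: "q $ 0 = 0" and c: "1 + c + c ^ 2 + c ^ 3 + c ^ 4 = 0"
  shows "qinf q q * qinf (c * q) q * qinf (c ^ 4 * q) q * qinf (c ^ 2 * q) q * qinf (c ^ 3 * q) q
    = qinf (q ^ 5) (q ^ 5)"
proof (rule LIMSEQ_unique)
  have c5: "c ^ 5 = 1"
  proof -
    have "c ^ 5 - 1 = (c - 1) * (1 + c + c ^ 2 + c ^ 3 + c ^ 4)"
      by (simp add: algebra_simps flip: power_Suc) (simp add: eval_nat_numeral)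
    then show ?thesis using c by simp
  qed
  have *: "(1 - y) * (1 - c * y) * (1 - c ^ 4 * y) * (1 - c ^ 2 * y) * (1 - c ^ 3 * y) = 1 - y ^ 5"
    for y
  proof -
    \<comment> \<open>Each root is paired with its inverse. The middle coefficients \<open>u\<close>
      and \<open>v\<close> of the two quadratics have sum -1 and product -1, like the numbers (-1 +-
      sqrt 5)/2.\<close>
    define u v where "u = c + c ^ 4" and "v = c ^ 2 + c ^ 3"
    have uv: "u + v = - 1"
      using c by (simp add: u_def v_def algebra_simps eq_neg_iff_add_eq_0)
    have "u * v = c ^ 3 + c ^ 4 + c * c ^ 5 + c ^ 2 * c ^ 5"
      by (simp add: u_def v_def algebra_simps eval_nat_numeral)
    also have "\<dots> = u + v"
      unfolding c5 by (simp add: u_def v_def algebra_simps)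
    finally have uv': "u * v = - 1" using uv by simp
    have "(1 - c * y) * (1 - c ^ 4 * y) = 1 - u * y + c ^ 5 * y ^ 2"
      "(1 - c ^ 2 * y) * (1 - c ^ 3 * y) = 1 - v * y + c ^ 5 * y ^ 2"
      by (simp_all add: u_def v_def algebra_simps eval_nat_numeral)
    then have "(1 - c * y) * (1 - c ^ 4 * y) * ((1 - c ^ 2 * y) * (1 - c ^ 3 * y))
        = (1 - u * y + y ^ 2) * (1 - v * y + y ^ 2)"
      by (simp add: c5)
    also have "\<dots> = 1 - (u + v) * y + (2 + u * v) * y ^ 2 - (u + v) * y ^ 3 + y ^ 4"
      by (simp add: algebra_simps eval_nat_numeral)
    also have "\<dots> = 1 + y + y ^ 2 + y ^ 3 + y ^ 4"
      unfolding uv uv' by simp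
    finally have "(1 - y) * (1 - c * y) * (1 - c ^ 4 * y) * (1 - c ^ 2 * y) * (1 - c ^ 3 * y)
        = (1 - y) * (1 + y + y ^ 2 + y ^ 3 + y ^ 4)"
      by (simp only: mult.assoc)
    also have "\<dots> = 1 - y ^ 5"
      by (simp add: algebra_simps eval_nat_numeral)
    finally show ?thesis .
  qed
  define P where "P N = qpoch q q N * qpoch (c * q) q N * qpoch (c ^ 4 * q) q N
      * qpoch (c ^ 2 * q) q N * qpoch (c ^ 3 * q) q N" for N
  have "P N = qpoch (q ^ 5) (q ^ 5) N" for N
  proof (induction N)
    case (Suc N)
    define y where "y = q * q ^ N"
    have "P (Suc N) = P N * ((1 - y) * (1 - c * y) * (1 - c ^ 4 * y) * (1 - c ^ 2 * y) * (1 - c ^ 3 * y))"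
      by (simp only: P_def qpoch_Suc y_def mult_ac)
    also have "\<dots> = P N * (1 - y ^ 5)"
      by (simp only: *)
    also have "y ^ 5 = q ^ 5 * (q ^ 5) ^ N"
      unfolding y_def by (simp only: power_mult_distrib power_mult[symmetric] mult.commute)
    finally show ?case
      by (simp only: qpoch_Suc Suc)
  qed (simp add: P_def)
  moreover have "P \<longlonglongrightarrow> qinf q q * qinf (c * q) q * qinf (c ^ 4 * q) q
      * qinf (c ^ 2 * q) q * qinf (c ^ 3 * q) q"
    unfolding P_def by (intro tendsto_mult_fps qpoch_tendsto_qinf q)
  ultimately show "qpoch (q ^ 5) (q ^ 5) \<longlonglongrightarrow> qinf q q * qinf (c * q) q * qinf (c ^ 4 * q) q
      * qinf (c ^ 2 * q) q * qinf (c ^ 3 * q) q"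
    by presburger
  show "qpoch (q ^ 5) (q ^ 5) \<longlonglongrightarrow> qinf (q ^ 5) (q ^ 5)"
    using q by (intro qpoch_tendsto_qinf) (simp add: fps_power_zeroth)
qed

section \<open>Gaussian binomials and the Jacobi triple product\<close>

fun qbin :: "'a :: comm_ring_1 \<Rightarrow> nat \<Rightarrow> nat \<Rightarrow> 'a" where
  "qbin q n 0 = 1"
| "qbin q 0 (Suc k) = 0"
| "qbin q (Suc n) (Suc k) = qbin q n (Suc k) + q ^ (n - k) * qbin q n k"

lemma qbin_eq_0: "n < k \<Longrightarrow> qbin q n k = 0"
  by (induction q n k rule: qbin.induct) auto

text \<open>The quotient formula for Gaussian binomials with denominators cleared, so that it makes
  sense in every commutative ring.\<close>

lemma qbin_mult_qpoch:
  "k \<le> n \<Longrightarrow> qbin q n k * qpoch q q k * qpoch q q (n - k) = qpoch q q n"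
proof (induction n arbitrary: k)
  case (Suc n)
  show ?case
  proof (cases k)
    case (Suc j)
    then have j: "j \<le> n" using Suc.prems by simp
    have 1: "qbin q n (Suc j) * qpoch q q (Suc j) * qpoch q q (n - j)
      = qpoch q q n * (1 - q ^ (n - j))"
    proof (cases "j = n")
      case False
      then have "n - j = Suc (n - Suc j)" using j by simp
      then have "qpoch q q (n - j) = qpoch q q (n - Suc j) * (1 - q ^ (n - j))"
        by (metis qpoch_Suc power_Suc)
      then show ?thesis
        using Suc.IH[of "Suc j"] False j by (simp add: mult.assoc[symmetric])
    qed (simp add: qbin_eq_0)
    have 2: "q ^ (n - j) * qbin q n j * qpoch q q (Suc j) * qpoch q q (n - j)
      = qpoch q q n * (q ^ (n - j) * (1 - q ^ Suc j))"
      unfolding Suc.IH[OF j, symmetric] by (simp add: qpoch_Suc mult_ac)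
    \<comment> \<open>This splits 1 - q^(n+1) into 1 - q^(n-j) and q^(n-j) (1 - q^(j+1)), matching
      the two terms of the q-Pascal rule.\<close>
    have "q ^ (n - j) * q ^ Suc j = q ^ Suc n"
      using j by (simp flip: power_add power_Suc)
    then have "qpoch q q (Suc n) = qpoch q q n * (1 - q ^ (n - j)) + qpoch q q n * (q ^ (n - j) * (1 - q ^ Suc j))"
      by (simp add: qpoch_Suc algebra_simps)
    then show ?thesis
      unfolding Suc using 1 2 by (simp add: distrib_right)
  qed simp
qed simp

lemma zero_choose_2 [simp]: "0 choose 2 = 0"
  by (simp add: numeral_2_eq_2)

lemma Suc_choose_2: "Suc n choose 2 = n + (n choose 2)"
  by (simp add: numeral_2_eq_2)

text \<open>The finite q-binomial theorem, kept homogeneous: the triple product takes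
  \<open>s = q ^ N\<close>, which replaces the negative powers of q in the usual argument.\<close>

lemma prod_add_mult_power:
  fixes s t q :: "'a :: comm_ring_1"
  shows "(\<Prod>k<n. s + t * q ^ k) = (\<Sum>j\<le>n. qbin q n j * q ^ (j choose 2) * t ^ j * s ^ (n - j))"
proof (induction n)
  case (Suc n)
  define f where "f n j = qbin q n j * q ^ (j choose 2) * t ^ j * s ^ (n - j)" for n j
  have f: "f (Suc n) (Suc j) = f n (Suc j) * s + f n j * (t * q ^ n)" if "j \<le> n" for j
  proof -
    have e: "q ^ (n - j) * q ^ j = q ^ n"
      using that by (simp flip: power_add)
    \<comment> \<open>For \<open>j = n\<close> the truncated exponent is off by one, but then the
      Gaussian binomial vanishes.\<close>
    have s: "qbin q n (Suc j) * s ^ (n - j) = qbin q n (Suc j) * s ^ (n - Suc j) * s"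
    proof (cases "j = n")
      case False
      then have "n - j = Suc (n - Suc j)" using that by simp
      then show ?thesis by (simp add: mult_ac)
    qed (simp add: qbin_eq_0)
    have "f (Suc n) (Suc j) = qbin q n (Suc j) * s ^ (n - j) * q ^ (Suc j choose 2) * t ^ Suc j
        + (q ^ (n - j) * q ^ j) * q ^ (j choose 2) * qbin q n j * t ^ Suc j * s ^ (n - j)"
      by (simp add: f_def Suc_choose_2 power_add algebra_simps)
    then show ?thesis
      unfolding e s by (simp add: f_def mult_ac)
  qed
  have "(\<Sum>j\<le>Suc n. f (Suc n) j) = f (Suc n) 0 + (\<Sum>j\<le>n. f n (Suc j) * s + f n j * (t * q ^ n))"
    by (subst sum.atMost_Suc_shift) (simp add: f)
  also have "\<dots> = (f n 0 + (\<Sum>j\<le>n. f n (Suc j))) * s + (\<Sum>j\<le>n. f n j) * (t * q ^ n)"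
    by (simp add: sum.distrib sum_distrib_right[symmetric] distrib_right) (simp add: f_def mult_ac)
  also have "f n 0 + (\<Sum>j\<le>n. f n (Suc j)) = (\<Sum>j\<le>n. f n j)"
    by (subst sum.atMost_Suc_shift[symmetric]) (simp add: f_def qbin_eq_0)
  finally show ?case
    using Suc by (simp add: f_def algebra_simps)
qed simp

lemma add_choose_2: "(m + n) choose 2 = (m choose 2) + (n choose 2) + m * n"
  by (induction n) (simp_all add: Suc_choose_2)

lemma two_times_choose_2: "2 * (m choose 2) + m = m * m"
  by (induction m) (simp_all add: Suc_choose_2)

lemma choose_2_ge: "m \<le> Suc (m choose 2)"
  by (induction m) (auto simp add: Suc_choose_2)

lemma prod_power_eq_choose_2: "(\<Prod>k<n. q ^ k) = q ^ (n choose 2)"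
  by (induction n) (simp_all add: Suc_choose_2 power_add mult.commute)

lemma prod_lessThan_add:
  fixes f :: "nat \<Rightarrow> 'a :: comm_monoid_mult"
  shows "(\<Prod>k<m + n. f k) = (\<Prod>k<m. f k) * (\<Prod>k<n. f (m + k))"
  by (induction n) (simp_all add: mult.assoc)

text \<open>One half of the bilateral series with terms a^k q^(k(k-1)/2). If
  \<open>a * b = q\<close>, the term k = -m equals b^m q^(m(m-1)/2), so the other half has the same
  shape in \<open>b\<close> and no inverse of \<open>a\<close> is written.\<close>

definition jtp_term :: "'a :: comm_ring_1 \<Rightarrow> 'a \<Rightarrow> nat \<Rightarrow> 'a" where
  "jtp_term q a m = a ^ m * q ^ (m choose 2)"

text \<open>The product of q^N + a q^k over k < 2N is evaluated twice: by the finite q-binomial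
  theorem, and by taking a q^k out of the lower half and q^N out of the upper half of its factors.
  The monomials taken out form \<open>M\<close>, which is cancelled.\<close>

lemma finite_jacobi_triple_product:
  fixes q a b :: "'a :: idom"
  assumes ab: "a * b = q" and q: "q \<noteq> 0"
  shows "qpoch (- a) q N * qpoch (- b) q N
    = (\<Sum>m\<le>N. qbin q (2 * N) (N - m) * jtp_term q b m)
      + (\<Sum>m<N. qbin q (2 * N) (N + Suc m) * jtp_term q a (Suc m))"
proof -
  define M where "M = q ^ (N * N + (N choose 2)) * a ^ N"
  have "a \<noteq> 0" using ab q by auto
  then have M: "M \<noteq> 0" using q by (simp add: M_def)
  define f where "f j = qbin q (2 * N) j * q ^ (j choose 2) * a ^ j * (q ^ N) ^ (2 * N - j)" for j
  have lower: "(\<Prod>k<N. q ^ N + a * q ^ k) = q ^ (N choose 2) * a ^ N * qpoch (- b) q N"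
  proof -
    have "(\<Prod>k<N. q ^ N + a * q ^ k) = (\<Prod>k<N. q ^ k * a * (1 + b * q ^ (N - Suc k)))"
    proof (rule prod.cong)
      fix k assume "k \<in> {..<N}"
      then have "q ^ N = q ^ k * q * q ^ (N - Suc k)"
        by (metis lessThan_iff power_Suc2 power_add le_add_diff_inverse Suc_leI)
      then show "q ^ N + a * q ^ k = q ^ k * a * (1 + b * q ^ (N - Suc k))"
        by (simp add: ab[symmetric] algebra_simps)
    qed simp
    also have "\<dots> = q ^ (N choose 2) * a ^ N * (\<Prod>k<N. 1 + b * q ^ (N - Suc k))"
      by (simp add: prod.distrib prod_power_eq_choose_2)
    also have "(\<Prod>k<N. 1 + b * q ^ (N - Suc k)) = qpoch (- b) q N"
      unfolding qpoch_def by (subst prod.nat_diff_reindex) simp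
    finally show ?thesis .
  qed
  have "(\<Prod>k<N. q ^ N + a * q ^ (N + k)) = (\<Prod>k<N. q ^ N * (1 - (- a) * q ^ k))"
    by (simp add: power_add algebra_simps)
  then have upper: "(\<Prod>k<N. q ^ N + a * q ^ (N + k)) = q ^ (N * N) * qpoch (- a) q N"
    by (simp add: prod.distrib qpoch_def power_mult)
  have "(\<Prod>k<N + N. q ^ N + a * q ^ k)
      = (\<Prod>k<N. q ^ N + a * q ^ k) * (\<Prod>k<N. q ^ N + a * q ^ (N + k))"
    by (rule prod_lessThan_add)
  then have "M * (qpoch (- a) q N * qpoch (- b) q N) = (\<Prod>k<2 * N. q ^ N + a * q ^ k)"
    unfolding mult_2 lower upper by (simp add: M_def power_add mult_ac)
  also have "\<dots> = (\<Sum>j\<le>2 * N. f j)"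
    unfolding prod_add_mult_power f_def ..
  also have "{..2 * N} = {..N} \<union> {Suc N..2 * N}"
    by auto
  also have "sum f ({..N} \<union> {Suc N..2 * N}) = sum f {..N} + sum f {Suc N..2 * N}"
    by (rule sum.union_disjoint) auto
  also have "sum f {..N} = (\<Sum>m\<le>N. f (N - m))"
    by (rule sum.reindex_bij_witness[of _ "\<lambda>m. N - m" "\<lambda>m. N - m"]) auto
  also have "sum f {Suc N..2 * N} = (\<Sum>m<N. f (N + Suc m))"
    by (rule sum.reindex_bij_witness[of _ "\<lambda>m. N + Suc m" "\<lambda>j. j - Suc N"]) auto
  also have "(\<Sum>m\<le>N. f (N - m)) = (\<Sum>m\<le>N. M * (qbin q (2 * N) (N - m) * jtp_term q b m))"
  proof (rule sum.cong)
    fix m assume "m \<in> {..N}"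
    define j where "j = N - m"
    then have N: "N = j + m" using \<open>m \<in> _\<close> by simp
    have e: "(N * N + (N choose 2)) + ((m choose 2) + m) = (j choose 2) + N * (2 * N - j)"
      using two_times_choose_2[of m] by (simp add: N add_choose_2 algebra_simps)
    \<comment> \<open>Of the \<open>N\<close> factors \<open>a\<close>, \<open>m\<close> pair off
      with the factors \<open>b\<close>, each pair giving \<open>q\<close>.\<close>
    have "a ^ N * b ^ m = a ^ j * q ^ m"
      by (simp add: N power_add ab[symmetric] power_mult_distrib)
    then have "M * (qbin q (2 * N) j * jtp_term q b m) =
        qbin q (2 * N) j * (q ^ ((N * N + (N choose 2)) + ((m choose 2) + m))) * a ^ j"
      by (simp add: M_def jtp_term_def power_add mult_ac)
    also have "\<dots> = f j"
      unfolding e by (simp add: f_def power_add power_mult mult_ac)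
    finally show "f (N - m) = M * (qbin q (2 * N) (N - m) * jtp_term q b m)"
      by (simp add: j_def)
  qed simp
  also have "(\<Sum>m<N. f (N + Suc m)) = (\<Sum>m<N. M * (qbin q (2 * N) (N + Suc m) * jtp_term q a (Suc m)))"
  proof (rule sum.cong)
    fix m' assume "m' \<in> {..<N}"
    define m where "m = Suc m'"
    then obtain r where N: "N = m + r" using \<open>m' \<in> _\<close> by (metis lessThan_iff Suc_leI le_Suc_ex)
    have e: "((N + m) choose 2) + N * (2 * N - (N + m)) = N * N + (N choose 2) + (m choose 2)"
      unfolding add_choose_2[of N m] by (simp add: N algebra_simps)
    have "f (N + m) = qbin q (2 * N) (N + m) * q ^ (((N + m) choose 2) + N * (2 * N - (N + m))) * a ^ (N + m)"
      by (simp add: f_def power_add power_mult mult_ac)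
    then show "f (N + Suc m') = M * (qbin q (2 * N) (N + Suc m') * jtp_term q a (Suc m'))"
      unfolding e m_def[symmetric] by (simp add: M_def jtp_term_def power_add mult_ac)
  qed simp
  finally show ?thesis
    using M by (simp add: sum_distrib_left[symmetric] distrib_left[symmetric])
qed

text \<open>With the Gaussian binomial written as a quotient, two Pochhammer products stand over two
  others, and all four tend to \<open>qinf q q\<close>.\<close>

lemma qpoch_mult_qbin_tendsto_1:
  fixes q :: "'a :: field fps"
  assumes q: "q $ 0 = 0" and le: "\<And>N. N \<ge> N0 \<Longrightarrow> h N \<le> 2 * N"
    and h: "filterlim h at_top sequentially" "filterlim (\<lambda>N. 2 * N - h N) at_top sequentially"
  shows "(\<lambda>N. qpoch q q N * qbin q (2 * N) (h N)) \<longlonglongrightarrow> 1"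
proof -
  have nz: "qpoch q q n \<noteq> 0" "qpoch q q n $ 0 = 1" for n
    using qpoch_nth_0[OF q] by (metis fps_zero_nth zero_neq_one)+
  have lim: "(\<lambda>N. qpoch q q N * qpoch q q (2 * N) * (inverse (qpoch q q (h N))
      * inverse (qpoch q q (2 * N - h N))))
    \<longlonglongrightarrow> qinf q q * qinf q q * (inverse (qinf q q) * inverse (qinf q q))"
    by (intro tendsto_mult_fps tendsto_inverse_fps qpoch_tendsto_qinf' qpoch_tendsto_qinf q h
        mult_nat_left_at_top) (use q in simp_all)
  have "qinf q q * inverse (qinf q q) = 1"
    using q by (simp add: inverse_mult_eq_1')
  then have "qinf q q * qinf q q * (inverse (qinf q q) * inverse (qinf q q)) = 1"
    by (metis mult.assoc mult.commute mult_1)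
  moreover have "\<forall>\<^sub>F N in sequentially. qpoch q q N * qpoch q q (2 * N) * (inverse (qpoch q q (h N))
      * inverse (qpoch q q (2 * N - h N))) = qpoch q q N * qbin q (2 * N) (h N)"
    using eventually_ge_at_top[of N0]
  proof eventually_elim
    case (elim N)
    have inv: "qpoch q q n * inverse (qpoch q q n) = 1" for n
      using nz by (simp add: inverse_mult_eq_1')
    have "qpoch q q (2 * N) = qbin q (2 * N) (h N) * qpoch q q (h N) * qpoch q q (2 * N - h N)"
      using qbin_mult_qpoch[OF le[OF elim], of q] by simp
    then have "qpoch q q N * qpoch q q (2 * N) * (inverse (qpoch q q (h N))
      * inverse (qpoch q q (2 * N - h N))) = qpoch q q N * qbin q (2 * N) (h N)
        * (qpoch q q (h N) * inverse (qpoch q q (h N)))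
        * (qpoch q q (2 * N - h N) * inverse (qpoch q q (2 * N - h N)))"
      by (simp only: mult_ac)
    then show ?case by (simp add: inv)
  qed
  ultimately show ?thesis
    using Lim_transform_eventually lim by fastforce
qed

text \<open>Limit of the finite form, one coefficient at a time. The factor q^(m choose 2) alone
  hides the terms with \<open>m > Suc n\<close> from coefficient \<open>n\<close>
  (\<open>choose_2_ge\<close>), so \<open>a\<close> may have a nonzero constant term, as in the
  application where it is a constant.\<close>

theorem jacobi_triple_product:
  fixes q a b :: "'a :: field fps"
  assumes q: "q $ 0 = 0" "q \<noteq> 0" and ab: "a * b = q"
  shows "(qinf q q * (qinf (- a) q * qinf (- b) q)) $ n
    = (\<Sum>m\<le>Suc n. (jtp_term q b m + jtp_term q a (Suc m)) $ n)"
proof -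
  define g where "g N j = qpoch q q N * qbin q (2 * N) j" for N j
  have g: "qpoch q q N * (qpoch (- a) q N * qpoch (- b) q N)
    = (\<Sum>m\<le>N. g N (N - m) * jtp_term q b m) + (\<Sum>m<N. g N (N + Suc m) * jtp_term q a (Suc m))" for N
    unfolding finite_jacobi_triple_product[OF ab q(2)]
    by (simp add: g_def distrib_left sum_distrib_left mult.assoc)
  have g1: "(\<lambda>N. g N (N - m)) \<longlonglongrightarrow> 1" for m
    unfolding g_def
    by (rule qpoch_mult_qbin_tendsto_1[OF q(1), of m])
       (auto intro!: filterlim_at_top_mono[OF filterlim_ident] filterlim_minus_const_nat_at_top always_eventually)
  have g2: "(\<lambda>N. g N (N + m)) \<longlonglongrightarrow> 1" for m
  proof -
    have "filterlim (\<lambda>N. 2 * N - (N + m)) at_top sequentially"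
      using filterlim_minus_const_nat_at_top[of m] by (rule filterlim_cong[THEN iffD1, rotated -1]) auto
    then show ?thesis
      unfolding g_def
      by (intro qpoch_mult_qbin_tendsto_1[OF q(1), of m])
         (auto intro!: filterlim_at_top_mono[OF filterlim_ident])
  qed
  have small: "(f * jtp_term q c m) $ n = 0" if "m > Suc n" for f c m
  proof -
    have "n < m choose 2" using that choose_2_ge[of m] by simp
    then show ?thesis
      using fps_mult_power_nth_eq_0[OF q(1), of n "m choose 2" "f * c ^ m"]
      by (simp add: jtp_term_def mult.assoc)
  qed
  have "\<forall>\<^sub>F N in sequentially. \<forall>m\<in>{..Suc n}. (g N (N - m) * jtp_term q b m) $ n = jtp_term q b m $ n"
    using tendsto_mult_fps[OF g1 tendsto_const]
    by (subst eventually_ball_finite_distrib) (auto simp: tendsto_fps_iff)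
  moreover have "\<forall>\<^sub>F N in sequentially. \<forall>m\<in>{..Suc n}. (g N (N + Suc m) * jtp_term q a (Suc m)) $ n = jtp_term q a (Suc m) $ n"
    using tendsto_mult_fps[OF g2 tendsto_const]
    by (subst eventually_ball_finite_distrib) (auto simp: tendsto_fps_iff simp del: add_Suc_right)
  moreover have "\<forall>\<^sub>F N in sequentially. (qpoch q q N * (qpoch (- a) q N * qpoch (- b) q N)) $ n
      = (qinf q q * (qinf (- a) q * qinf (- b) q)) $ n"
    using tendsto_mult_fps[OF qpoch_tendsto_qinf[OF q(1), of q]
        tendsto_mult_fps[OF qpoch_tendsto_qinf[OF q(1), of "-a"] qpoch_tendsto_qinf[OF q(1), of "-b"]]]
    by (simp add: tendsto_fps_iff)
  ultimately have "\<forall>\<^sub>F N in sequentially. (qinf q q * (qinf (- a) q * qinf (- b) q)) $ n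
    = (\<Sum>m\<le>Suc n. (jtp_term q b m + jtp_term q a (Suc m)) $ n)"
    \<comment> \<open>\<open>N\<close> has to exceed \<open>Suc n\<close> because the second finite
      sum stops at \<open>N - 1\<close>.\<close>
    using eventually_ge_at_top[of "n + 2"]
  proof eventually_elim
    case (elim N)
    have 1: "(\<Sum>m\<le>N. (g N (N - m) * jtp_term q b m) $ n) = (\<Sum>m\<le>Suc n. (g N (N - m) * jtp_term q b m) $ n)"
      by (rule sum.mono_neutral_right) (use elim(4) in \<open>auto simp: small\<close>)
    have 2: "(\<Sum>m<N. (g N (N + Suc m) * jtp_term q a (Suc m)) $ n)
        = (\<Sum>m\<le>Suc n. (g N (N + Suc m) * jtp_term q a (Suc m)) $ n)"
      by (rule sum.mono_neutral_right) (use elim(4) in \<open>auto simp del: add_Suc_right simp: small\<close>)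
    have "(qinf q q * (qinf (- a) q * qinf (- b) q)) $ n = (\<Sum>m\<le>N. (g N (N - m) * jtp_term q b m) $ n)
      + (\<Sum>m<N. (g N (N + Suc m) * jtp_term q a (Suc m)) $ n)"
      using elim(3) unfolding g by (simp add: fps_sum_nth)
    also have "\<dots> = (\<Sum>m\<le>Suc n. jtp_term q b m $ n) + (\<Sum>m\<le>Suc n. jtp_term q a (Suc m) $ n)"
      unfolding 1 2 using elim(1,2) by (intro arg_cong2[of _ _ _ _ "(+)"] sum.cong) auto
    finally show ?case
      by (simp add: sum.distrib)
  qed
  then show ?thesis
    by simp
qed

section \<open>The q-binomial theorem\<close>

definition fps_sums :: "(nat \<Rightarrow> 'a :: comm_ring_1 fps) \<Rightarrow> 'a fps" where
  "fps_sums f = Abs_fps (\<lambda>n. \<Sum>j\<le>n. f j $ n)"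

text \<open>The cut at \<open>j \<le> n\<close> in \<open>fps_sums\<close> loses nothing once the
  \<open>j\<close>-th series starts at exponent \<open>j\<close> or later.\<close>

lemma fps_sums_tendsto:
  assumes "\<And>j n. n < j \<Longrightarrow> f j $ n = 0"
  shows "(\<lambda>J. \<Sum>j\<le>J. f j) \<longlonglongrightarrow> fps_sums f"
proof (rule tendsto_fpsI)
  fix n
  show "\<forall>\<^sub>F J in sequentially. (\<Sum>j\<le>J. f j) $ n = fps_sums f $ n"
    using eventually_ge_at_top[of n]
  proof eventually_elim
    case (elim J)
    have "(\<Sum>j\<le>J. f j $ n) = (\<Sum>j\<le>n. f j $ n)"
      by (rule sum.mono_neutral_right) (use elim assms in auto)
    then show ?case
      by (simp add: fps_sums_def fps_sum_nth)
  qed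
qed

text \<open>The series F satisfies (1 - z) F(z) = (1 - a z) F(q z). Iterating K times produces the
  two Pochhammer products, and F(q^K z) tends to 1.\<close>

theorem q_binomial_theorem:
  fixes q a z :: "'a :: field fps"
  assumes q: "q $ 0 = 0" and z: "z $ 0 = 0"
  shows "qinf z q * fps_sums (\<lambda>j. qpoch a q j * inverse (qpoch q q j) * z ^ j) = qinf (a * z) q"
proof -
  define t where "t j = qpoch a q j * inverse (qpoch q q j)" for j
  define F where "F z = fps_sums (\<lambda>j. t j * z ^ j)" for z
  have t0: "t 0 = 1"
    by (simp add: t_def)
  have t: "t (Suc j) * (1 - q ^ Suc j) = t j * (1 - a * q ^ j)" for j
  proof -
    have "(1 - q ^ Suc j) $ 0 = 1"
      using q by simp
    then have "(1 - q ^ Suc j) * inverse (1 - q ^ Suc j) = 1"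
      by (metis inverse_mult_eq_1 mult.commute zero_neq_one)
    moreover have "t (Suc j) * (1 - q ^ Suc j) =
      t j * (1 - a * q ^ j) * ((1 - q ^ Suc j) * inverse (1 - q ^ Suc j))"
      by (simp add: t_def qpoch_Suc fps_inverse_mult mult_ac)
    ultimately show ?thesis by simp
  qed
  have lim: "(\<lambda>J. \<Sum>j\<le>J. t j * z ^ j) \<longlonglongrightarrow> F z" if "z $ 0 = 0" for z
    unfolding F_def by (rule fps_sums_tendsto) (rule fps_mult_power_nth_eq_0[OF that])
  have step: "(1 - z) * F z = (1 - a * z) * F (q * z)" if z: "z $ 0 = 0" for z
  proof -
    define S where "S z J = (\<Sum>j\<le>J. t j * z ^ j)" for z J
    \<comment> \<open>The functional equation in the form F(z) - F(qz) = z (F(z) - a F(qz)) holds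
      exactly for partial sums if the right side has one term fewer; it is the recursion
      \<open>t\<close>, summed.\<close>
    have S: "S z (Suc J) - S (q * z) (Suc J) = z * (S z J - a * S (q * z) J)" for J
    proof (induction J)
      case 0
      show ?case
        using arg_cong[OF t[of 0], of "(*) z"] by (simp add: S_def t0 algebra_simps)
    next
      case (Suc J)
      have "S z (Suc (Suc J)) - S (q * z) (Suc (Suc J))
          = S z (Suc J) - S (q * z) (Suc J) + t (Suc (Suc J)) * (1 - q ^ Suc (Suc J)) * z ^ Suc (Suc J)"
        by (simp add: S_def algebra_simps power_mult_distrib)
      also have "\<dots> = z * (S z J - a * S (q * z) J) + z * (t (Suc J) * z ^ Suc J - a * (t (Suc J) * (q * z) ^ Suc J))"
        unfolding Suc t by (simp add: algebra_simps power_mult_distrib)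
      also have "\<dots> = z * (S z (Suc J) - a * S (q * z) (Suc J))"
        by (simp add: S_def algebra_simps)
      finally show ?case .
    qed
    have "(q * z) $ 0 = 0" using z by simp
    note lims = lim[OF z, folded S_def] lim[OF this, folded S_def]
    note lims' = filterlim_compose[OF lims(1) filterlim_Suc] filterlim_compose[OF lims(2) filterlim_Suc]
    have "F z - F (q * z) = z * (F z - a * F (q * z))"
    proof (rule LIMSEQ_unique)
      show "(\<lambda>J. S z (Suc J) - S (q * z) (Suc J)) \<longlonglongrightarrow> F z - F (q * z)"
        by (intro tendsto_diff_fps lims')
      show "(\<lambda>J. S z (Suc J) - S (q * z) (Suc J)) \<longlonglongrightarrow> z * (F z - a * F (q * z))"
        unfolding S by (intro tendsto_diff_fps tendsto_mult_fps tendsto_const lims)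
    qed
    then show ?thesis by (simp add: algebra_simps)
  qed
  have iter: "qpoch z q K * F z = qpoch (a * z) q K * F (q ^ K * z)" for K
  proof (induction K)
    case (Suc K)
    have "qpoch z q (Suc K) * F z = (1 - q ^ K * z) * (qpoch z q K * F z)"
      by (simp add: qpoch_Suc mult_ac)
    also have "\<dots> = qpoch (a * z) q K * ((1 - q ^ K * z) * F (q ^ K * z))"
      unfolding Suc by (simp add: mult_ac)
    also have "\<dots> = qpoch (a * z) q (Suc K) * F (q ^ Suc K * z)"
      using step[of "q ^ K * z"] z by (simp add: qpoch_Suc mult_ac)
    finally show ?case .
  qed simp
  have F1: "(\<lambda>K. F (q ^ K * z)) \<longlonglongrightarrow> 1"
  proof (rule tendsto_fpsI)
    fix n
    show "\<forall>\<^sub>F K in sequentially. F (q ^ K * z) $ n = 1 $ n"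
      using eventually_gt_at_top[of n]
    proof eventually_elim
      case (elim K)
      have "(t j * (q ^ K * z) ^ j) $ n = 0" if "j > 0" for j
      proof -
        have "n < K * j" using that elim by (metis Suc_leI mult.commute mult_le_mono1 nat_mult_1 order_less_le_trans One_nat_def)
        then show ?thesis
          using fps_mult_power_nth_eq_0[OF q, of n "K * j" "t j * z ^ j"]
          by (simp add: power_mult_distrib power_mult mult_ac)
      qed
      then have "(\<Sum>j\<le>n. (t j * (q ^ K * z) ^ j) $ n) = (\<Sum>j\<in>{0}. (t j * (q ^ K * z) ^ j) $ n)"
        by (intro sum.mono_neutral_right) auto
      then show ?case
        by (simp add: F_def fps_sums_def t0)
    qed
  qed
  have "qinf z q * F z = qinf (a * z) q * 1"
  proof (rule LIMSEQ_unique)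
    show "(\<lambda>K. qpoch z q K * F z) \<longlonglongrightarrow> qinf z q * F z"
      by (intro tendsto_mult_fps tendsto_const qpoch_tendsto_qinf q)
    show "(\<lambda>K. qpoch z q K * F z) \<longlonglongrightarrow> qinf (a * z) q * 1"
      unfolding iter by (intro tendsto_mult_fps F1 qpoch_tendsto_qinf q)
  qed
  then show ?thesis
    by (simp add: F_def t_def)
qed

section \<open>Generating functions of lists\<close>

text \<open>A sum over an infinite fibre of \<open>sz\<close> is 0 by default, which is why the
  rules for unions and products ask for finite fibres.\<close>

definition gf :: "'b set \<Rightarrow> ('b \<Rightarrow> nat) \<Rightarrow> ('b \<Rightarrow> 'a :: comm_ring_1) \<Rightarrow> 'a fps" where
  "gf A sz wt = Abs_fps (\<lambda>n. \<Sum>a | a \<in> A \<and> sz a = n. wt a)"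

lemma gf_nth: "gf A sz wt $ n = (\<Sum>a | a \<in> A \<and> sz a = n. wt a)"
  by (simp add: gf_def)

lemma gf_cong:
  assumes "A = B" "\<And>a. a \<in> B \<Longrightarrow> sz a = sz' a" "\<And>a. a \<in> B \<Longrightarrow> wt a = wt' a"
  shows "gf A sz wt = gf B sz' wt'"
  unfolding gf_def using assms by (auto intro!: arg_cong[of _ _ Abs_fps] sum.cong)

lemma gf_reindex:
  assumes f: "bij_betw f A B"
    and sz: "\<And>a. a \<in> A \<Longrightarrow> szB (f a) = k + szA a"
    and wt: "\<And>a. a \<in> A \<Longrightarrow> wtB (f a) = c * wtA a"
  shows "gf B szB wtB = fps_const c * fps_X ^ k * gf A szA wtA"
proof (rule fps_ext)
  fix n
  have nth: "(fps_const c * fps_X ^ k * gf A szA wtA) $ n = (if n < k then 0 else c * gf A szA wtA $ (n - k))"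
    by (simp add: mult.assoc fps_X_power_mult_nth)
  have B: "B = f ` A" and inj: "inj_on f A"
    using f by (auto simp: bij_betw_def)
  show "gf B szB wtB $ n = (fps_const c * fps_X ^ k * gf A szA wtA) $ n"
  proof (cases "n < k")
    case True
    then have "{b. b \<in> B \<and> szB b = n} = {}"
      using sz by (auto simp: B)
    then show ?thesis
      unfolding nth using True by (simp only: gf_nth sum.empty if_True)
  next
    case False
    then have "{b. b \<in> B \<and> szB b = n} = f ` {a. a \<in> A \<and> szA a = n - k}"
      using sz by (auto simp: B)
    moreover have "inj_on f {a. a \<in> A \<and> szA a = n - k}"
      using inj by (rule inj_on_subset) auto
    ultimately show ?thesis
      unfolding nth gf_nth using False wt by (simp add: sum.reindex sum_distrib_left)
  qed
qed

lemma gf_Un_disjoint: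
  assumes "A \<inter> B = {}" "\<And>n. finite {a. a \<in> A \<and> sz a = n}" "\<And>n. finite {a. a \<in> B \<and> sz a = n}"
  shows "gf (A \<union> B) sz wt = gf A sz wt + gf B sz wt"
proof (rule fps_ext)
  fix n
  have "{a. a \<in> A \<union> B \<and> sz a = n} = {a. a \<in> A \<and> sz a = n} \<union> {a. a \<in> B \<and> sz a = n}"
    by auto
  then show "gf (A \<union> B) sz wt $ n = (gf A sz wt + gf B sz wt) $ n"
    unfolding gf_nth fps_add_nth using assms by (simp only:) (intro sum.union_disjoint; auto)
qed

lemma gf_Times:
  assumes fin: "\<And>n. finite {a. a \<in> A \<and> sz a = n}" "\<And>n. finite {b. b \<in> B \<and> sz' b = n}"
  shows "gf (A \<times> B) (\<lambda>(a, b). sz a + sz' b) (\<lambda>(a, b). wt a * wt' b) = gf A sz wt * gf B sz' wt'"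
proof (rule fps_ext)
  fix n
  have "{p. p \<in> A \<times> B \<and> (case p of (a, b) \<Rightarrow> sz a + sz' b) = n}
      = (\<Union>i\<in>{0..n}. {a. a \<in> A \<and> sz a = i} \<times> {b. b \<in> B \<and> sz' b = n - i})"
    by auto
  then have "gf (A \<times> B) (\<lambda>(a, b). sz a + sz' b) (\<lambda>(a, b). wt a * wt' b) $ n
    = (\<Sum>i=0..n. \<Sum>(a, b)\<in>{a. a \<in> A \<and> sz a = i} \<times> {b. b \<in> B \<and> sz' b = n - i}. wt a * wt' b)"
    unfolding gf_nth by (simp only:) (intro sum.UNION_disjoint; use fin in auto)
  then show "gf (A \<times> B) (\<lambda>(a, b). sz a + sz' b) (\<lambda>(a, b). wt a * wt' b) $ n = (gf A sz wt * gf B sz' wt') $ n"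
    by (simp add: fps_mult_nth gf_nth sum_product sum.cartesian_product)
qed

text \<open>The relation is a parameter because the same recursions count two kinds of sequences:
  partitions (\<open>dominates\<close>) and the sequences of pair sums in Boulet's decomposition
  (\<open>pair_rel\<close>).\<close>

definition parts_wrt :: "(nat \<Rightarrow> nat \<Rightarrow> bool) \<Rightarrow> nat list set" where
  "parts_wrt R = {xs. sorted_wrt R xs \<and> (\<forall>x\<in>set xs. 0 < x)}"

definition parts_wrt_le :: "(nat \<Rightarrow> nat \<Rightarrow> bool) \<Rightarrow> nat \<Rightarrow> nat list set" where
  "parts_wrt_le R N = {xs \<in> parts_wrt R. \<forall>x\<in>set xs. x \<le> N}"

abbreviation (input) dominates :: "nat \<Rightarrow> nat \<Rightarrow> bool" where
  "dominates \<equiv> (\<lambda>a b. b \<le> a)"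

lemma is_partition_iff: "is_partition xs \<longleftrightarrow> xs \<in> parts_wrt dominates"
  by (simp add: is_partition_def parts_wrt_def)

lemma length_le_sum_list_pos: "\<forall>x\<in>set xs. 0 < x \<Longrightarrow> length xs \<le> sum_list xs"
  for xs :: "nat list"
  by (induction xs) force+

lemma finite_lists_pos: "finite {xs :: nat list. (\<forall>x\<in>set xs. 0 < x) \<and> sum_list xs \<le> n}"
proof (rule finite_subset)
  show "finite {xs. set xs \<subseteq> {..n} \<and> length xs \<le> n}"
    by (rule finite_lists_length_le) simp
  show "{xs :: nat list. (\<forall>x\<in>set xs. 0 < x) \<and> sum_list xs \<le> n} \<subseteq> {xs. set xs \<subseteq> {..n} \<and> length xs \<le> n}"
    using length_le_sum_list_pos member_le_sum_list by (fastforce intro: order_trans)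
qed

lemma finite_fibre:
  fixes r n :: nat
  assumes "A \<subseteq> {xs. \<forall>x\<in>set xs. 0 < x}" "0 < r"
  shows "finite {xs. xs \<in> A \<and> r * sum_list xs = n}"
proof (rule finite_subset[OF _ finite_lists_pos[of n]], safe)
  fix xs x assume "xs \<in> A" "n = r * sum_list xs"
  show "sum_list xs \<le> r * sum_list xs" using assms(2) by simp
qed (use assms in auto)

lemma parts_wrt_pos: "parts_wrt R \<subseteq> {xs. \<forall>x\<in>set xs. 0 < x}"
  "parts_wrt_le R N \<subseteq> {xs. \<forall>x\<in>set xs. 0 < x}"
  by (auto simp: parts_wrt_def parts_wrt_le_def)

text \<open>The factor \<open>r\<close> counts each unit as \<open>r\<close> cells, so that the
  crank series can be taken directly in q^4. A part never exceeds the size, hence the bound has no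
  effect on coefficient \<open>n\<close> from \<open>N = n\<close> on.\<close>

lemma gf_parts_wrt_le_tendsto:
  assumes "0 < r"
  shows "(\<lambda>N. gf (parts_wrt_le R N) (\<lambda>xs. r * sum_list xs) wt)
    \<longlonglongrightarrow> gf (parts_wrt R) (\<lambda>xs. r * sum_list xs) wt"
proof (rule tendsto_fpsI)
  fix n
  show "\<forall>\<^sub>F N in sequentially. gf (parts_wrt_le R N) (\<lambda>xs. r * sum_list xs) wt $ n
      = gf (parts_wrt R) (\<lambda>xs. r * sum_list xs) wt $ n"
    using eventually_ge_at_top[of n]
  proof eventually_elim
    case (elim N)
    have "x \<le> N" if "x \<in> set xs" "r * sum_list xs = n" for xs x
    proof -
      have "x \<le> sum_list xs" using that(1) by (intro member_le_sum_list) auto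
      also have "\<dots> \<le> n" using that(2) assms by auto
      finally show ?thesis using elim by simp
    qed
    then have "{xs. xs \<in> parts_wrt_le R N \<and> r * sum_list xs = n} = {xs. xs \<in> parts_wrt R \<and> r * sum_list xs = n}"
      by (auto simp: parts_wrt_le_def)
    then show ?case by (simp only: gf_nth)
  qed
qed

lemma gf_parts_wrt_le_0: "wt [] = 1 \<Longrightarrow> gf (parts_wrt_le R 0) sz wt = fps_X ^ sz []"
proof -
  assume wt: "wt [] = 1"
  have "xs \<in> parts_wrt_le R 0 \<longleftrightarrow> xs = []" for xs
    by (cases xs) (auto simp: parts_wrt_le_def parts_wrt_def)
  then have "{xs. xs \<in> parts_wrt_le R 0 \<and> sz xs = n} = (if n = sz [] then {[]} else {})" for n
    by auto
  then have "gf (parts_wrt_le R 0) sz wt $ n = (if n = sz [] then 1 else 0)" for n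
    unfolding gf_nth using wt by simp
  then show ?thesis
    by (simp add: fps_eq_iff)
qed

text \<open>A list bounded by \<open>Suc N\<close> either avoids \<open>Suc N\<close> or arises from
  another such list by one more \<open>Suc N\<close> in front: a geometric series, multiplied out.
  \<open>c\<close> is the weight of a single part \<open>Suc N\<close>.\<close>

lemma gf_parts_wrt_le_Suc_repeat:
  assumes "\<And>a b. R a b \<Longrightarrow> b \<le> a" "\<And>b. b \<le> Suc N \<Longrightarrow> R (Suc N) b" and r: "0 < r"
    and wt: "\<And>xs. wt (Suc N # xs) = c * wt xs"
  shows "(1 - fps_const c * fps_X ^ (r * Suc N)) * gf (parts_wrt_le R (Suc N)) (\<lambda>xs. r * sum_list xs) wt
    = gf (parts_wrt_le R N) (\<lambda>xs. r * sum_list xs) wt"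
proof -
  let ?A = "parts_wrt_le R (Suc N)" and ?B = "parts_wrt_le R N" and ?sz = "\<lambda>xs. r * sum_list xs"
  have A: "?A = ?B \<union> Cons (Suc N) ` ?A"
  proof safe
    fix xs assume xs: "xs \<in> ?A" "xs \<notin> Cons (Suc N) ` ?A"
    show "xs \<in> ?B"
    proof (cases xs)
      case (Cons x ys)
      have ys: "\<forall>y\<in>set ys. R x y"
        using xs(1) by (simp add: Cons parts_wrt_le_def parts_wrt_def)
      have "ys \<in> ?A"
        using xs(1) by (auto simp: Cons parts_wrt_le_def parts_wrt_def)
      then have "x \<noteq> Suc N"
        using xs(2) by (auto simp: Cons)
      then have "x \<le> N"
        using xs(1) by (simp add: Cons parts_wrt_le_def)
      moreover have "\<forall>y\<in>set ys. y \<le> x"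
        using ys assms(1) by blast
      ultimately show ?thesis
        using xs(1) by (auto simp: Cons parts_wrt_le_def)
    qed (simp add: parts_wrt_le_def parts_wrt_def)
  next
    fix xs assume "xs \<in> ?A" then show "Suc N # xs \<in> ?A"
      using assms(2) by (auto simp: parts_wrt_le_def parts_wrt_def)
  qed (auto simp: parts_wrt_le_def parts_wrt_def)
  have "Cons (Suc N) ` ?A \<subseteq> ?A" using A by blast
  then have pos: "Cons (Suc N) ` ?A \<subseteq> {xs. \<forall>x\<in>set xs. 0 < x}" using parts_wrt_pos(2) by blast
  have "gf ?A ?sz wt = gf (?B \<union> Cons (Suc N) ` ?A) ?sz wt"
    using A by (rule arg_cong[where f = "\<lambda>S. gf S ?sz wt"])
  also have "\<dots> = gf ?B ?sz wt + gf (Cons (Suc N) ` ?A) ?sz wt"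
  proof (rule gf_Un_disjoint)
    show "?B \<inter> Cons (Suc N) ` ?A = {}"
      by (auto simp: parts_wrt_le_def)
  qed (rule finite_fibre[OF _ r], rule pos parts_wrt_pos)+
  also have "gf (Cons (Suc N) ` ?A) ?sz wt = fps_const c * fps_X ^ (r * Suc N) * gf ?A ?sz wt"
  proof (rule gf_reindex[where f = "Cons (Suc N)"])
    show "wt (Suc N # xs) = c * wt xs" for xs by (rule wt)
  qed (simp_all add: bij_betw_def distrib_left)
  finally show ?thesis
    unfolding left_diff_distrib mult_1_left diff_eq_eq .
qed

text \<open>Here \<open>R\<close> forbids a second \<open>Suc N\<close>, so removing it leaves a
  list bounded by \<open>N\<close>, and the geometric series shrinks to two terms.\<close>

lemma gf_parts_wrt_le_Suc_once:
  assumes "\<And>a b. R a b \<Longrightarrow> b \<le> a" "\<And>b. R (Suc N) b \<longleftrightarrow> b \<le> N" and r: "0 < r"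
    and wt: "\<And>xs. wt (Suc N # xs) = c * wt xs"
  shows "gf (parts_wrt_le R (Suc N)) (\<lambda>xs. r * sum_list xs) wt
    = (1 + fps_const c * fps_X ^ (r * Suc N)) * gf (parts_wrt_le R N) (\<lambda>xs. r * sum_list xs) wt"
proof -
  let ?A = "parts_wrt_le R (Suc N)" and ?B = "parts_wrt_le R N" and ?sz = "\<lambda>xs. r * sum_list xs"
  have A: "?A = ?B \<union> Cons (Suc N) ` ?B"
  proof safe
    fix xs assume xs: "xs \<in> ?A" "xs \<notin> Cons (Suc N) ` ?B"
    show "xs \<in> ?B"
    proof (cases xs)
      case (Cons x ys)
      have ys: "\<forall>y\<in>set ys. R x y"
        using xs(1) by (simp add: Cons parts_wrt_le_def parts_wrt_def)
      have "ys \<in> ?B"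
        if "x = Suc N"
        using xs(1) assms(2) that by (auto simp: Cons parts_wrt_le_def parts_wrt_def)
      then have "x \<noteq> Suc N"
        using xs(2) by (auto simp: Cons)
      then have "x \<le> N"
        using xs(1) by (simp add: Cons parts_wrt_le_def)
      moreover have "\<forall>y\<in>set ys. y \<le> x"
        using ys assms(1) by blast
      ultimately show ?thesis
        using xs(1) by (auto simp: Cons parts_wrt_le_def)
    qed (simp add: parts_wrt_le_def parts_wrt_def)
  next
    fix xs assume "xs \<in> ?B" then show "Suc N # xs \<in> ?A"
      using assms(2) by (auto simp: parts_wrt_le_def parts_wrt_def)
  qed (auto simp: parts_wrt_le_def parts_wrt_def)
  have "Cons (Suc N) ` ?B \<subseteq> ?A" using A by blast
  then have pos: "Cons (Suc N) ` ?B \<subseteq> {xs. \<forall>x\<in>set xs. 0 < x}" using parts_wrt_pos(2) by blast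
  have "gf ?A ?sz wt = gf (?B \<union> Cons (Suc N) ` ?B) ?sz wt"
    using A by (rule arg_cong[where f = "\<lambda>S. gf S ?sz wt"])
  also have "\<dots> = gf ?B ?sz wt + gf (Cons (Suc N) ` ?B) ?sz wt"
  proof (rule gf_Un_disjoint)
    show "?B \<inter> Cons (Suc N) ` ?B = {}"
      by (auto simp: parts_wrt_le_def)
  qed (rule finite_fibre[OF _ r], rule pos parts_wrt_pos)+
  also have "gf (Cons (Suc N) ` ?B) ?sz wt = fps_const c * fps_X ^ (r * Suc N) * gf ?B ?sz wt"
  proof (rule gf_reindex[where f = "Cons (Suc N)"])
    show "wt (Suc N # xs) = c * wt xs" for xs by (rule wt)
  qed (simp_all add: bij_betw_def distrib_left)
  finally show ?thesis
    by (simp add: algebra_simps)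
qed

text \<open>Boulet's decomposition works with a fixed number of rows. Zeros stand at the end of a
  sorted list, and a partition of \<open>n\<close> has at most \<open>n\<close> parts, so
  \<open>m\<close> rows with zeros allowed already see all of them.\<close>

lemma sum_zero_padded:
  assumes R: "\<And>a b. R a b \<Longrightarrow> b \<le> a" "\<And>a. R a 0"
    and wt: "\<And>xs k. wt (xs @ replicate k 0) = wt xs" and n: "n \<le> m"
  shows "(\<Sum>xs | length xs = m \<and> sorted_wrt R xs \<and> sum_list xs = n. wt xs)
    = (\<Sum>xs | xs \<in> parts_wrt R \<and> sum_list xs = n. wt xs)"
proof -
  define pos where "pos = filter (\<lambda>x :: nat. 0 < x)"
  define pad where "pad xs = xs @ replicate (m - length xs) (0 :: nat)" for xs
  have pos_pad: "pos xs @ replicate (length xs - length (pos xs)) 0 = xs" if "sorted_wrt R xs" for xs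
    using that
  proof (induction xs)
    case (Cons x xs)
    show ?case
    proof (cases "x = 0")
      case True
      then have "xs = replicate (length xs) 0"
        using Cons.prems R(1) by (intro replicate_eqI) fastforce+
      then have "pos xs = []" by (metis filter_False in_set_replicate pos_def not_less_zero)
      then show ?thesis using True \<open>xs = _\<close> by (simp add: pos_def)
    next
      case False
      then show ?thesis using Cons by (simp add: pos_def)
    qed
  qed (simp add: pos_def)
  have sum_pos: "sum_list (pos xs) = sum_list xs" for xs
    by (induction xs) (auto simp: pos_def)
  show ?thesis
  proof (rule sum.reindex_bij_witness[where i = pad and j = pos])
    fix xs assume "xs \<in> {xs. length xs = m \<and> sorted_wrt R xs \<and> sum_list xs = n}"
    then have xs: "length xs = m" "sorted_wrt R xs" "sum_list xs = n" by auto
    show "pad (pos xs) = xs"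
      using pos_pad[OF xs(2)] xs(1) by (simp add: pad_def)
    show "pos xs \<in> {xs. xs \<in> parts_wrt R \<and> sum_list xs = n}"
      using xs sum_pos[of xs] by (auto simp: parts_wrt_def pos_def sorted_wrt_filter)
    show "wt (pos xs) = wt xs"
      using wt[of "pos xs"] pos_pad[OF xs(2)] by metis
  next
    fix xs assume "xs \<in> {xs. xs \<in> parts_wrt R \<and> sum_list xs = n}"
    then have xs: "\<forall>x\<in>set xs. 0 < x" "sorted_wrt R xs" "sum_list xs = n" by (auto simp: parts_wrt_def)
    then have "length xs \<le> m"
      using length_le_sum_list_pos[of xs] n by simp
    moreover have "sorted_wrt R (replicate k 0)" for k
      using R(2) by (induction k) auto
    ultimately show "pad xs \<in> {xs. length xs = m \<and> sorted_wrt R xs \<and> sum_list xs = n}"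
      using xs R(2) by (auto simp: pad_def sorted_wrt_append sum_list_replicate)
    show "pos (pad xs) = xs"
      using xs(1) by (auto simp: pos_def pad_def intro!: filter_True)
  qed
qed

section \<open>Stanley's rank\<close>

fun alt_sum :: "nat list \<Rightarrow> int" where
  "alt_sum [] = 0"
| "alt_sum (x # xs) = int x - alt_sum xs"

text \<open>The alternating sum counts the odd parts of the conjugate
  (\<open>odd_parts_conj\<close>). This form avoids columns and also applies to lists padded with
  zeros. The division is exact.\<close>

definition half_srank :: "nat list \<Rightarrow> int" where
  "half_srank xs = (int (odd_parts xs) - alt_sum xs) div 2"

lemma fold_max_le_iff: "fold max xs a \<le> N \<longleftrightarrow> a \<le> N \<and> (\<forall>x\<in>set xs. x \<le> (N :: nat))"
  by (induction xs arbitrary: a) auto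

lemma largest_le_iff: "largest xs \<le> N \<longleftrightarrow> (\<forall>x\<in>set xs. x \<le> N)"
  by (simp add: largest_def fold_max_le_iff)

lemma le_largest: "x \<in> set xs \<Longrightarrow> x \<le> largest xs"
  using largest_le_iff[of xs "largest xs"] by simp

text \<open>A new longest row of length \<open>x\<close> adds one cell to each of the columns 1 to
  \<open>x\<close> and so flips their parity; all later columns are empty.\<close>

lemma card_odd_columns:
  assumes "sorted_wrt dominates xs" "\<forall>x\<in>set xs. x \<le> N"
  shows "int (card {j \<in> {1..N}. odd (length (filter (\<lambda>x. j \<le> x) xs))}) = alt_sum xs"
  using assms
proof (induction xs arbitrary: N)
  case (Cons x xs)
  define B where "B = {j \<in> {1..x}. odd (length (filter (\<lambda>y. j \<le> y) xs))}"
  have B: "B \<subseteq> {1..x}"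
    by (auto simp: B_def)
  have le: "\<forall>y\<in>set xs. y \<le> x"
    using Cons.prems by simp
  have "filter (\<lambda>y. j \<le> y) xs = []" if "\<not> j \<le> x" for j
    using le that by (auto simp: filter_empty_conv)
  then have "{j \<in> {1..N}. odd (length (filter (\<lambda>y. j \<le> y) (x # xs)))} = {1..x} - B"
    using Cons.prems(2) by (auto simp: B_def split: if_splits)
  moreover have "card ({1..x} - B) = x - card B" "card B \<le> x"
    using card_Diff_subset[of B "{1..x}"] card_mono[of "{1..x}" B] finite_subset[OF B] B by auto
  moreover have "int (card B) = alt_sum xs"
    unfolding B_def using Cons.IH[of x] Cons.prems(1) le by simp
  ultimately show ?case
    by simp
qed simp

lemma odd_parts_conj:
  assumes "is_partition xs"
  shows "int (odd_parts (conj xs)) = alt_sum xs"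
proof -
  let ?L = "largest xs" and ?P = "\<lambda>j. odd (length (filter (\<lambda>x. j \<le> x) xs))"
  have "odd_parts (conj xs) = length (filter ?P [1..<Suc ?L])"
    by (simp add: odd_parts_def conj_def length_filter_map comp_def del: upt_Suc)
  also have "\<dots> = card (Collect ?P \<inter> set [1..<Suc ?L])"
    by (rule distinct_length_filter) simp
  also have "Collect ?P \<inter> set [1..<Suc ?L] = {j \<in> {1..?L}. ?P j}"
    by auto
  finally show ?thesis
    using card_odd_columns[of xs ?L] assms le_largest by (simp add: is_partition_def)
qed

lemma even_odd_parts_diff_alt_sum: "even (int (odd_parts xs) - alt_sum xs)"
  by (induction xs) (auto simp: odd_parts_def)

lemma srank_eq: "is_partition xs \<Longrightarrow> srank xs = 2 * half_srank xs"
  using even_odd_parts_diff_alt_sum[of xs] by (simp add: srank_def odd_parts_conj half_srank_def)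

lemma half_srank_eqI:
  "int (odd_parts xs) - alt_sum xs = int (odd_parts ys) - alt_sum ys \<Longrightarrow> half_srank xs = half_srank ys"
  by (simp add: half_srank_def)

lemma alt_sum_append: "even (length xs) \<Longrightarrow> alt_sum (xs @ ys) = alt_sum xs + alt_sum ys"
  "odd (length xs) \<Longrightarrow> alt_sum (xs @ ys) = alt_sum xs - alt_sum ys"
  by (induction xs) auto

lemma alt_sum_replicate: "alt_sum (replicate m x) = (if even m then 0 else int x)"
  by (induction m) auto

lemma odd_parts_append: "odd_parts (xs @ ys) = odd_parts xs + odd_parts ys"
  by (simp add: odd_parts_def)

lemma odd_parts_replicate: "odd_parts (replicate m x) = (if odd x then m else 0)"
  by (simp add: odd_parts_def)

lemma half_srank_append_zeros: "half_srank (xs @ replicate k 0) = half_srank xs"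
  by (rule half_srank_eqI, cases "even (length xs)")
     (simp_all add: alt_sum_append alt_sum_replicate odd_parts_append odd_parts_replicate)

text \<open>A pair sum s stands for the rows ceil(s/2) and floor(s/2); the relation says that the
  lower row of the first pair is at least as long as the upper row of the second. It is reflexive
  exactly at even numbers, so odd sums occur at most once.\<close>

definition pair_rel :: "nat \<Rightarrow> nat \<Rightarrow> bool" where
  "pair_rel a b \<longleftrightarrow> (b + 1) div 2 \<le> a div 2"

lemma transp_pair_rel: "transp pair_rel"
  unfolding pair_rel_def by (intro transpI) (meson add_leE div_le_mono le_add1 order_trans)

lemma pair_rel_le: "pair_rel a b \<Longrightarrow> b \<le> a"
  unfolding pair_rel_def by presburger

text \<open>Boulet's decomposition: rows \<^term>\<open>2 * i\<close> and \<^term>\<open>2 * i + 1\<close> (counting from 0) have difference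
  \<^term>\<open>2 * d + e\<close> with \<^term>\<open>e < 2\<close>. Removing \<^term>\<open>d\<close> pairs of columns of length \<^term>\<open>2 * i + 1\<close> for every
  \<^term>\<open>i\<close> leaves pairs of rows that are determined by their sums \<^term>\<open>s\<close>.\<close>

fun rows_of_pairs :: "(nat \<times> nat) list \<Rightarrow> nat list" where
  "rows_of_pairs [] = []"
| "rows_of_pairs ((s, d) # r) = ((s + 1) div 2 + 2 * d + 2 * sum_list (map snd r))
     # (s div 2 + 2 * sum_list (map snd r)) # rows_of_pairs r"

text \<open>For \<open>c = 2\<close> the coefficients are 2, 6, 10 and so on: two columns of length
  2i+1 have 4i+2 cells.\<close>

fun weighted_sum :: "nat \<Rightarrow> nat list \<Rightarrow> nat" where
  "weighted_sum c [] = 0"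
| "weighted_sum c (d # ds) = c * d + weighted_sum (c + 4) ds"

lemma weighted_sum_add: "weighted_sum (c + k) ds = weighted_sum c ds + k * sum_list ds"
proof (induction ds arbitrary: c)
  case (Cons d ds)
  then show ?case using Cons[of "c + 4"] by (simp add: algebra_simps)
qed simp

lemma length_rows_of_pairs: "length (rows_of_pairs r) = 2 * length r"
  by (induction r rule: rows_of_pairs.induct) auto

lemma sum_list_rows_of_pairs:
  "sum_list (rows_of_pairs r) = sum_list (map fst r) + weighted_sum 2 (map snd r)"
proof (induction r rule: rows_of_pairs.induct)
  case (2 s d r)
  have "(s + 1) div 2 + s div 2 = s" by presburger
  then show ?case
    using 2 weighted_sum_add[of 2 4 "map snd r"] by simp
qed simp

text \<open>Column pairs change row lengths by even amounts, so parities depend on the sums only: s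
  = 2 modulo 4 gives two equal odd rows and contributes 1, any other s balances to 0. Each unit of d
  widens the gap inside its pair by 2 and costs 1.\<close>

lemma half_srank_rows_of_pairs:
  "half_srank (rows_of_pairs r) = int (length (filter (\<lambda>s. s mod 4 = 2) (map fst r))) - int (sum_list (map snd r))"
proof -
  have "int (odd_parts (rows_of_pairs r)) - alt_sum (rows_of_pairs r)
    = 2 * (int (length (filter (\<lambda>s. s mod 4 = 2) (map fst r))) - int (sum_list (map snd r)))"
  proof (induction r rule: rows_of_pairs.induct)
    case (2 s d r)
    define x y where "x = (s + 1) div 2 + 2 * d + 2 * sum_list (map snd r)"
      and "y = s div 2 + 2 * sum_list (map snd r)"
    define e where "e = (if s mod 4 = 2 then 1 else 0 :: int)"
    have x: "x mod 2 = ((s + 1) div 2) mod 2" and y: "y mod 2 = (s div 2) mod 2"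
      by (simp_all add: x_def y_def)
    \<comment> \<open>The balance of one pair without column pairs, arranged without subtraction and
      checked on the residues of \<open>s\<close> modulo 4.\<close>
    have "((s + 1) div 2) mod 2 + (s div 2) mod 2 + s div 2 = (s + 1) div 2 + 2 * (if s mod 4 = 2 then 1 else 0)"
    proof -
      obtain k j where s: "s = 4 * k + j" "j < 4"
        using that[of "s div 4" "s mod 4"] by simp
      then consider "j = 0" | "j = 1" | "j = 2" | "j = 3" by linarith
      then show ?thesis
        unfolding s(1) by cases (simp_all, presburger+)
    qed
    moreover have "int a + int b - (int (a' + 2 * d + 2 * t) - int (c + 2 * t)) = 2 * (e - int d)"
      if "a + b + c = a' + 2 * (if s mod 4 = 2 then 1 else 0)" for a b a' c t
      using that by (simp add: e_def split: if_splits)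
    ultimately have "int (x mod 2) + int (y mod 2) - (int x - int y) = 2 * (e - int d)"
      unfolding x y unfolding x_def y_def by blast
    moreover have "int (odd_parts (rows_of_pairs ((s, d) # r)))
        = int (x mod 2) + int (y mod 2) + int (odd_parts (rows_of_pairs r))"
    proof -
      have "odd_parts (u # v # xs) = u mod 2 + v mod 2 + odd_parts xs" for u v xs
        by (simp add: odd_parts_def mod2_eq_if)
      then show ?thesis
        unfolding rows_of_pairs.simps x_def[symmetric] y_def[symmetric] by simp
    qed
    moreover have "alt_sum (rows_of_pairs ((s, d) # r)) = int x - int y + alt_sum (rows_of_pairs r)"
      unfolding rows_of_pairs.simps x_def[symmetric] y_def[symmetric] by simp
    moreover have "int (length (filter (\<lambda>s. s mod 4 = 2) (map fst ((s, d) # r))))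
        = e + int (length (filter (\<lambda>s. s mod 4 = 2) (map fst r)))"
      "int (sum_list (map snd ((s, d) # r))) = int d + int (sum_list (map snd r))"
      by (simp_all add: e_def)
    ultimately show ?case
      using 2 by algebra
  qed (simp add: odd_parts_def)
  then show ?thesis by (simp add: half_srank_def)
qed

lemma transp_dominates: "transp dominates"
  by (auto intro: transpI)

lemma sorted_rows_of_pairs:
  "sorted_wrt pair_rel (map fst r) \<Longrightarrow> sorted_wrt dominates (rows_of_pairs r)"
proof (induction r rule: rows_of_pairs.induct)
  case (2 s d r)
  have s: "(s + 1) div 2 \<ge> s div 2" by presburger
  show ?case
  proof (cases r)
    case Nil
    then show ?thesis using s by simp
  next
    case (Cons p r')
    obtain s' d' where p: "p = (s', d')" by force
    have "pair_rel s s'" "sorted_wrt dominates (rows_of_pairs r)"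
      using 2 by (auto simp: Cons p)
    then show ?thesis
      using s unfolding Cons p rows_of_pairs.simps sorted_wrt2[OF transp_dominates]
      by (simp add: pair_rel_def)
  qed
qed simp

lemma inj_rows_of_pairs:
  "length r = length r' \<Longrightarrow> rows_of_pairs r = rows_of_pairs r' \<Longrightarrow> r = r'"
proof (induction r r' rule: list_induct2)
  case (Cons p r p' r')
  obtain s d s' d' where p: "p = (s, d)" "p' = (s', d')" by force
  have r: "r = r'" using Cons by (simp add: p)
  then have "s div 2 = s' div 2" "(s + 1) div 2 + 2 * d = (s' + 1) div 2 + 2 * d'"
    using Cons.prems by (auto simp: p)
  moreover have "(t + 1) div 2 = t div 2 + t mod 2" for t :: nat
    by presburger
  ultimately have e: "s mod 2 + 2 * d = s' mod 2 + 2 * d'"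
    by simp
  then have "(s mod 2 + 2 * d) mod 2 = (s' mod 2 + 2 * d') mod 2"
    by simp
  then have "s mod 2 = s' mod 2" by simp
  then have "s = s' \<and> d = d'"
    using e \<open>s div 2 = s' div 2\<close> by (metis add_left_cancel div_mult_mod_eq mult_left_cancel zero_neq_numeral)
  then show ?case using r by (simp add: p)
qed simp

lemma surj_rows_of_pairs:
  "length xs = 2 * m \<Longrightarrow> sorted_wrt dominates xs
    \<Longrightarrow> \<exists>r. length r = m \<and> sorted_wrt pair_rel (map fst r) \<and> rows_of_pairs r = xs"
proof (induction m arbitrary: xs)
  case (Suc m)
  then obtain x y ys where xs: "xs = x # y # ys"
    by (metis Suc_length_conv mult_Suc_right add_2_eq_Suc)
  have xy: "y \<le> x" using Suc.prems by (simp add: xs)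
  obtain r where r: "length r = m" "sorted_wrt pair_rel (map fst r)" "rows_of_pairs r = ys"
    using Suc.IH[of ys] Suc.prems by (auto simp: xs)
  \<comment> \<open>\<open>D\<close> is what the column pairs of later indices add to both rows. The
    parity of the gap \<open>x - y\<close> goes into \<open>s\<close>, the rest of the gap into
    \<open>d\<close>.\<close>
  define D where "D = 2 * sum_list (map snd r)"
  define s d where "s = 2 * (y - D) + (x - y) mod 2" and "d = (x - y) div 2"
  have "D \<le> y \<and> sorted_wrt pair_rel (s # map fst r)"
  proof (cases r)
    case (Cons p r')
    obtain s' d' where p: "p = (s', d')" by force
    have "(s' + 1) div 2 + D \<le> y"
      using Suc.prems r by (auto simp: xs Cons p D_def)
    then have "D \<le> y" "pair_rel s s'"
      by (simp_all add: pair_rel_def s_def)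
    then show ?thesis
      using r(2) by (simp add: Cons p sorted_wrt2[OF transp_pair_rel] del: sorted_wrt.simps)
  qed (simp add: D_def)
  moreover from this have "(s + 1) div 2 + 2 * d + D = x" "s div 2 + D = y"
  proof -
    have "(2 * a + b mod 2 + 1) div 2 = a + b mod 2" "(2 * a + b mod 2) div 2 = a" for a b :: nat
      by presburger+
    moreover have "(x - y) mod 2 + 2 * ((x - y) div 2) = x - y"
      by simp
    moreover assume "D \<le> y \<and> sorted_wrt pair_rel (s # map fst r)"
    ultimately show "(s + 1) div 2 + 2 * d + D = x" "s div 2 + D = y"
      using xy unfolding s_def d_def by auto
  qed
  ultimately show ?case
    using r by (intro exI[of _ "(s, d) # r"]) (simp add: xs D_def)
qed simp

section \<open>Generating functions of the two components of Boulet's decomposition\<close>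

lemma le_weighted_sum: "0 < c \<Longrightarrow> d \<in> set ds \<Longrightarrow> d \<le> weighted_sum c ds"
proof (induction ds arbitrary: c)
  case (Cons e ds)
  then show ?case
    by (cases "d = e") (auto intro: trans_le_add1 trans_le_add2)
qed simp

lemma finite_weighted_sum:
  "0 < c \<Longrightarrow> finite {ds. ds \<in> {ds. length ds = m} \<and> weighted_sum c ds = n}"
  by (rule finite_subset[OF _ finite_lists_length_eq[of "{..n}" m]]) (use le_weighted_sum in auto)

text \<open>Either the first entry is 0 and the remaining tuple starts at coefficient
  \<open>c + 4\<close>, or the first entry can be lowered by 1 against a factor w q^c.\<close>

lemma gf_weighted_sum:
  fixes w :: "'a :: comm_ring_1"
  assumes "0 < c"
  shows "gf {ds. length ds = m} (weighted_sum c) (\<lambda>ds. w ^ sum_list ds)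
      * qpoch (fps_const w * fps_X ^ c) (fps_X ^ 4) m = 1"
  using assms
proof (induction m arbitrary: c)
  case 0
  have "{ds. ds \<in> {ds. length ds = 0} \<and> weighted_sum c ds = n} = (if n = 0 then {[]} else {})" for n
    by auto
  then show ?case
    by (simp add: fps_eq_iff gf_nth)
next
  case (Suc m)
  let ?L = "\<lambda>m. {ds :: nat list. length ds = m}"
  let ?G = "\<lambda>c m. gf (?L m) (weighted_sum c) (\<lambda>ds. w ^ sum_list ds)"
  define inc where "inc ds = Suc (hd ds) # tl ds" for ds
  have L: "?L (Suc m) = Cons 0 ` ?L m \<union> inc ` ?L (Suc m)"
  proof safe
    fix ds :: "nat list" assume ds: "length ds = Suc m" "ds \<notin> inc ` ?L (Suc m)"
    then obtain d es where d: "ds = d # es" by (cases ds) auto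
    show "ds \<in> Cons 0 ` ?L m"
    proof (cases d)
      case (Suc e)
      then have "ds = inc (e # es)" "e # es \<in> ?L (Suc m)" using ds(1) by (simp_all add: d inc_def)
      then show ?thesis using ds(2) by blast
    qed (use ds d in auto)
  qed (auto simp: inc_def)
  have inj: "inj_on inc (?L (Suc m))"
    by (auto simp: inj_on_def inc_def intro: list.expand)
  have "?G c (Suc m) = gf (Cons 0 ` ?L m \<union> inc ` ?L (Suc m)) (weighted_sum c) (\<lambda>ds. w ^ sum_list ds)"
    using L by (rule arg_cong[where f = "\<lambda>S. gf S (weighted_sum c) (\<lambda>ds. w ^ sum_list ds)"])
  also have "\<dots> = gf (Cons 0 ` ?L m) (weighted_sum c) (\<lambda>ds. w ^ sum_list ds)
      + gf (inc ` ?L (Suc m)) (weighted_sum c) (\<lambda>ds. w ^ sum_list ds)"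
  proof (rule gf_Un_disjoint)
    show "finite {a. a \<in> Cons 0 ` ?L m \<and> weighted_sum c a = n}" for n
      by (rule finite_subset[OF _ finite_weighted_sum[OF Suc.prems, of "Suc m" n]]) auto
    show "finite {a. a \<in> inc ` ?L (Suc m) \<and> weighted_sum c a = n}" for n
      by (rule finite_subset[OF _ finite_weighted_sum[OF Suc.prems, of "Suc m" n]]) (auto simp: inc_def)
  qed (auto simp: inc_def)
  also have "gf (Cons 0 ` ?L m) (weighted_sum c) (\<lambda>ds. w ^ sum_list ds)
      = ?G (c + 4) m"
    by (subst gf_reindex[where f = "Cons 0" and k = 0 and c = 1 and A = "?L m"
          and szA = "weighted_sum (c + 4)" and wtA = "\<lambda>ds. w ^ sum_list ds"]) (auto simp: bij_betw_def)
  also have "gf (inc ` ?L (Suc m)) (weighted_sum c) (\<lambda>ds. w ^ sum_list ds)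
      = fps_const w * fps_X ^ c * ?G c (Suc m)"
  proof (rule gf_reindex[where f = inc])
    fix ds :: "nat list" assume "ds \<in> ?L (Suc m)"
    then obtain d es where "ds = d # es" by (cases ds) auto
    then show "weighted_sum c (inc ds) = c + weighted_sum c ds" "w ^ sum_list (inc ds) = w * w ^ sum_list ds"
      by (simp_all add: inc_def)
  qed (simp add: bij_betw_def inj)
  finally have G: "?G (c + 4) m = (1 - fps_const w * fps_X ^ c) * ?G c (Suc m)"
    unfolding left_diff_distrib mult_1_left eq_diff_eq by (rule sym)
  have "?G c (Suc m) * qpoch (fps_const w * fps_X ^ c) (fps_X ^ 4) (Suc m)
      = ?G (c + 4) m * qpoch (fps_const w * fps_X ^ (c + 4)) (fps_X ^ 4) m"
    unfolding G qpoch_Suc_shift power_add by (simp only: mult_ac)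
  then show ?case
    using Suc.IH[of "c + 4"] by simp
qed

definition pair_weight :: "'a :: comm_ring_1 \<Rightarrow> nat list \<Rightarrow> 'a" where
  "pair_weight z ss = z ^ length (filter (\<lambda>s. s mod 4 = 2) ss)"

text \<open>Even sums may repeat and give geometric series, with \<open>z\<close> exactly at 2
  modulo 4; odd sums occur at most once and give factors 1 + q^s. The induction runs over blocks of
  four part sizes, which hold one factor of each denominator.\<close>

lemma gf_pair_rel:
  fixes z :: "'a :: comm_ring_1"
  shows "gf (parts_wrt pair_rel) sum_list (pair_weight z)
      * qinf (fps_const z * fps_X\<^sup>2) (fps_X ^ 4) * qinf (fps_X ^ 4) (fps_X ^ 4) = qinf (- fps_X) (fps_X\<^sup>2)"
proof -
  let ?S = "\<lambda>N. gf (parts_wrt_le pair_rel N) (\<lambda>xs. 1 * sum_list xs) (pair_weight z)"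
  have rep: "(1 - fps_const c * fps_X ^ Suc N) * ?S (Suc N) = ?S N"
    if "odd N" "c = (if Suc N mod 4 = 2 then z else 1)" for N c
  proof -
    have "pair_rel (Suc N) b" if "b \<le> Suc N" for b
      using that \<open>odd N\<close> unfolding pair_rel_def by presburger
    then show ?thesis
      using gf_parts_wrt_le_Suc_repeat[of pair_rel N 1 "pair_weight z" c] that(2) pair_rel_le
      by (simp add: pair_weight_def)
  qed
  have once: "?S (Suc N) = (1 + fps_X ^ Suc N) * ?S N" if "even N" for N
  proof -
    have "Suc N mod 4 \<noteq> 2" using that by presburger
    moreover have "pair_rel (Suc N) b \<longleftrightarrow> b \<le> N" for b
      using that unfolding pair_rel_def by presburger
    ultimately show ?thesis
      using gf_parts_wrt_le_Suc_once[of pair_rel N 1 "pair_weight z" 1] pair_rel_le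
      by (simp add: pair_weight_def)
  qed
  have fin: "?S (4 * M) * qpoch (fps_const z * fps_X\<^sup>2) (fps_X ^ 4) M * qpoch (fps_X ^ 4) (fps_X ^ 4) M
    = qpoch (- fps_X) (fps_X\<^sup>2) (2 * M)" for M
  proof (induction M)
    case 0
    show ?case by (simp add: gf_parts_wrt_le_0 pair_weight_def)
  next
    case (Suc M)
    define N where "N = 4 * M"
    have S: "?S (N + 1) = (1 + fps_X ^ (N + 1)) * ?S N" "?S (N + 3) = (1 + fps_X ^ (N + 3)) * ?S (N + 2)"
      using once[of N] once[of "N + 2"] by (simp_all add: N_def numeral_3_eq_3)
    have e: "Suc (N + 1) = N + 2" "Suc (N + 3) = N + 4"
      by simp_all
    have "(N + 2) mod 4 = 2" "(N + 4) mod 4 = 0"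
      unfolding N_def by presburger+
    then have S': "(1 - fps_const z * fps_X ^ (N + 2)) * ?S (N + 2) = ?S (N + 1)"
       "(1 - fps_X ^ (N + 4)) * ?S (N + 4) = ?S (N + 3)"
      using rep[of "N + 1" z, unfolded e] rep[of "N + 3" 1, unfolded e] by (simp_all add: N_def)
    have q1: "qpoch (fps_const z * fps_X\<^sup>2) (fps_X ^ 4) (Suc M)
        = qpoch (fps_const z * fps_X\<^sup>2) (fps_X ^ 4) M * (1 - fps_const z * fps_X ^ (N + 2))"
      by (simp add: qpoch_Suc N_def mult.assoc flip: power_mult power_add)
    have q2: "qpoch (fps_X ^ 4) (fps_X ^ 4) (Suc M) = qpoch (fps_X ^ 4) (fps_X ^ 4) M * (1 - fps_X ^ (N + 4) :: 'a fps)"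
      by (simp add: qpoch_Suc N_def flip: power_mult power_add) (simp add: add.commute)
    have q3: "qpoch (- fps_X) (fps_X\<^sup>2) (2 * Suc M)
        = qpoch (- fps_X) (fps_X\<^sup>2) (2 * M) * (1 + fps_X ^ (N + 1)) * (1 + fps_X ^ (N + 3) :: 'a fps)"
      by (simp add: qpoch_Suc N_def numeral_3_eq_3 flip: power_mult power_Suc)
    have "?S (N + 4) * (qpoch (fps_const z * fps_X\<^sup>2) (fps_X ^ 4) M * (1 - fps_const z * fps_X ^ (N + 2)))
        * (qpoch (fps_X ^ 4) (fps_X ^ 4) M * (1 - fps_X ^ (N + 4)))
      = ((1 - fps_X ^ (N + 4)) * ?S (N + 4)) * (1 - fps_const z * fps_X ^ (N + 2))
        * qpoch (fps_const z * fps_X\<^sup>2) (fps_X ^ 4) M * qpoch (fps_X ^ 4) (fps_X ^ 4) M"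
      by (simp only: mult_ac)
    also have "\<dots> = (1 + fps_X ^ (N + 3)) * ((1 - fps_const z * fps_X ^ (N + 2)) * ?S (N + 2))
        * qpoch (fps_const z * fps_X\<^sup>2) (fps_X ^ 4) M * qpoch (fps_X ^ 4) (fps_X ^ 4) M"
      unfolding S'(2) S(2) by (simp only: mult_ac)
    also have "\<dots> = (1 + fps_X ^ (N + 3)) * (1 + fps_X ^ (N + 1)) * (?S N
        * qpoch (fps_const z * fps_X\<^sup>2) (fps_X ^ 4) M * qpoch (fps_X ^ 4) (fps_X ^ 4) M)"
      unfolding S'(1) S(1) by (simp only: mult_ac)
    also have "\<dots> = qpoch (- fps_X) (fps_X\<^sup>2) (2 * M) * (1 + fps_X ^ (N + 1)) * (1 + fps_X ^ (N + 3))"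
      using Suc.IH by (simp only: N_def mult_ac)
    finally show ?case
      unfolding q1 q2 q3 by (simp add: N_def add.commute)
  qed
  have X0: "(fps_X ^ 4 :: 'a fps) $ 0 = 0" "((fps_X :: 'a fps)\<^sup>2) $ 0 = 0" by simp_all
  show ?thesis
  proof (rule LIMSEQ_unique)
    show "(\<lambda>M. qpoch (- fps_X) (fps_X\<^sup>2) (2 * M)) \<longlonglongrightarrow> qinf (- fps_X) (fps_X\<^sup>2 :: 'a fps)"
      by (rule qpoch_tendsto_qinf'[OF X0(2)]) (simp add: mult_nat_left_at_top)
    have "(\<lambda>M. ?S (4 * M)) \<longlonglongrightarrow> gf (parts_wrt pair_rel) sum_list (pair_weight z)"
      using filterlim_compose[OF gf_parts_wrt_le_tendsto[of 1 pair_rel "pair_weight z"], of "\<lambda>M. 4 * M"]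
      by (simp add: mult_nat_left_at_top)
    then show "(\<lambda>M. qpoch (- fps_X) (fps_X\<^sup>2) (2 * M)) \<longlonglongrightarrow> gf (parts_wrt pair_rel) sum_list (pair_weight z)
      * qinf (fps_const z * fps_X\<^sup>2) (fps_X ^ 4) * qinf (fps_X ^ 4) (fps_X ^ 4)"
      unfolding fin[symmetric] by (intro tendsto_mult_fps qpoch_tendsto_qinf X0)
  qed
qed

text \<open>For each even number of rows the series factors into one for the pair sums and one for
  the column pairs; the latter is the reciprocal of a finite product and carries
  \<open>inverse z\<close>, since a column pair lowers half the srank. Then the number of rows
  grows.\<close>

theorem gf_half_srank:
  fixes z :: "'a :: field"
  assumes z: "z \<noteq> 0"
  shows "gf (parts_wrt dominates) sum_list (\<lambda>xs. z powi half_srank xs)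
      * qinf (fps_const (inverse z) * fps_X\<^sup>2) (fps_X ^ 4) * qinf (fps_const z * fps_X\<^sup>2) (fps_X ^ 4)
      * qinf (fps_X ^ 4) (fps_X ^ 4) = qinf (- fps_X) (fps_X\<^sup>2)"
proof -
  let ?wt = "\<lambda>xs. z powi half_srank xs" and ?pw = "pair_weight z"
  let ?U = "\<lambda>m. {xs :: nat list. length xs = 2 * m \<and> sorted_wrt dominates xs}"
  let ?V = "\<lambda>m. {ss. length ss = m \<and> sorted_wrt pair_rel ss}"
  let ?T = "\<lambda>m. {ds :: nat list. length ds = m}"
  define iz where "iz = inverse z"
  have U: "gf (?U m) sum_list ?wt = gf (?V m) sum_list ?pw * gf (?T m) (weighted_sum 2) (\<lambda>ds. iz ^ sum_list ds)" for m
  proof -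
    have bij: "bij_betw (\<lambda>(ss, ds). rows_of_pairs (zip ss ds)) (?V m \<times> ?T m) (?U m)"
    proof (rule bij_betwI')
      fix p p' assume "p \<in> ?V m \<times> ?T m" "p' \<in> ?V m \<times> ?T m"
      then obtain ss ds ss' ds' where p: "p = (ss, ds)" "p' = (ss', ds')"
        "length ss = m" "length ds = m" "length ss' = m" "length ds' = m" by auto
      show "((case p of (ss, ds) \<Rightarrow> rows_of_pairs (zip ss ds)) = (case p' of (ss, ds) \<Rightarrow> rows_of_pairs (zip ss ds))) = (p = p')"
        using inj_rows_of_pairs[of "zip ss ds" "zip ss' ds'"] p by (auto simp: zip_eq_conv)
    next
      fix p assume "p \<in> ?V m \<times> ?T m"
      then show "(case p of (ss, ds) \<Rightarrow> rows_of_pairs (zip ss ds)) \<in> ?U m"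
        by (auto simp: length_rows_of_pairs intro!: sorted_rows_of_pairs)
    next
      fix xs assume "xs \<in> ?U m"
      then obtain r where r: "length r = m" "sorted_wrt pair_rel (map fst r)" "rows_of_pairs r = xs"
        using surj_rows_of_pairs[of xs m] by auto
      then show "\<exists>p\<in>?V m \<times> ?T m. xs = (case p of (ss, ds) \<Rightarrow> rows_of_pairs (zip ss ds))"
        by (intro bexI[of _ "(map fst r, map snd r)"]) (auto simp: zip_map_fst_snd)
    qed
    have "gf (?U m) sum_list ?wt = fps_const 1 * fps_X ^ 0 * gf (?V m \<times> ?T m)
        (\<lambda>(ss, ds). sum_list ss + weighted_sum 2 ds) (\<lambda>(ss, ds). ?pw ss * iz ^ sum_list ds)"
      by (rule gf_reindex[OF bij])
         (auto simp: sum_list_rows_of_pairs half_srank_rows_of_pairs pair_weight_def iz_def z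
            power_int_diff power_inverse divide_inverse)
    also have "\<dots> = gf (?V m) sum_list ?pw * gf (?T m) (weighted_sum 2) (\<lambda>ds. iz ^ sum_list ds)"
    proof -
      have "finite {ss. ss \<in> ?V m \<and> sum_list ss = n}" for n
        by (rule finite_subset[OF _ finite_lists_length_eq[of "{..n}" m]]) (auto intro: member_le_sum_list)
      moreover have "finite {ds. ds \<in> ?T m \<and> weighted_sum 2 ds = n}" for n
        by (rule finite_weighted_sum) simp
      ultimately show ?thesis
        using gf_Times[of "?V m" sum_list "?T m" "weighted_sum 2" ?pw "\<lambda>ds. iz ^ sum_list ds"] by simp
    qed
    finally show ?thesis .
  qed
  have UV: "gf (?U m) sum_list ?wt * qpoch (fps_const iz * fps_X\<^sup>2) (fps_X ^ 4) m = gf (?V m) sum_list ?pw" for m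
    unfolding U mult.assoc using gf_weighted_sum[of 2 m iz] by simp
  have limU: "(\<lambda>m. gf (?U m) sum_list ?wt) \<longlonglongrightarrow> gf (parts_wrt dominates) sum_list ?wt"
  proof (rule tendsto_fpsI)
    fix n
    show "\<forall>\<^sub>F m in sequentially. gf (?U m) sum_list ?wt $ n = gf (parts_wrt dominates) sum_list ?wt $ n"
      using eventually_ge_at_top[of n]
    proof eventually_elim
      case (elim m)
      then show ?case
        using sum_zero_padded[of dominates ?wt n "2 * m"] by (simp add: gf_nth half_srank_append_zeros conj_assoc)
    qed
  qed
  have limV: "(\<lambda>m. gf (?V m) sum_list ?pw) \<longlonglongrightarrow> gf (parts_wrt pair_rel) sum_list ?pw"
  proof (rule tendsto_fpsI)
    fix n
    show "\<forall>\<^sub>F m in sequentially. gf (?V m) sum_list ?pw $ n = gf (parts_wrt pair_rel) sum_list ?pw $ n"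
      using eventually_ge_at_top[of n]
    proof eventually_elim
      case (elim m)
      have "pair_weight z (xs @ replicate k 0) = pair_weight z xs" for xs k
        by (simp add: pair_weight_def)
      moreover have "pair_rel a 0" for a by (simp add: pair_rel_def)
      ultimately show ?case
        using sum_zero_padded[of pair_rel ?pw n m] pair_rel_le elim by (simp add: gf_nth conj_assoc)
    qed
  qed
  have "gf (parts_wrt dominates) sum_list ?wt * qinf (fps_const iz * fps_X\<^sup>2) (fps_X ^ 4)
      = gf (parts_wrt pair_rel) sum_list ?pw"
  proof (rule LIMSEQ_unique[OF _ limV])
    show "(\<lambda>m. gf (?V m) sum_list ?pw) \<longlonglongrightarrow>
        gf (parts_wrt dominates) sum_list ?wt * qinf (fps_const iz * fps_X\<^sup>2) (fps_X ^ 4)"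
      unfolding UV[symmetric] by (intro tendsto_mult_fps limU qpoch_tendsto_qinf) simp
  qed
  then show ?thesis
    using gf_pair_rel[of z] by (simp add: iz_def)
qed

section \<open>Repeated even parts and partitions of type B\<close>

lemma count_list_mset: "count_list xs k = count (mset xs) k"
  by (induction xs) auto

lemma partition_eqI:
  assumes "xs \<in> parts_wrt dominates" "ys \<in> parts_wrt dominates" "\<And>k. count_list xs k = count_list ys k"
  shows "xs = ys"
proof -
  have "sorted (rev xs)" "sorted (rev ys)"
    using assms(1,2) by (simp_all add: parts_wrt_def sorted_wrt_rev)
  moreover have "mset (rev xs) = mset (rev ys)"
    using assms(3) by (simp add: multiset_eq_iff count_list_mset)
  ultimately show ?thesis
    by (metis properties_for_sort rev_rev_ident)
qed

section \<open>Partitions from multiplicities, and splitting off pairs of equal even parts\<close>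

definition of_counts :: "nat \<Rightarrow> (nat \<Rightarrow> nat) \<Rightarrow> nat list" where
  "of_counts N c = concat (map (\<lambda>k. replicate (c k) k) (rev [1..<Suc N]))"

lemma of_counts_0 [simp]: "of_counts 0 c = []"
  by (simp add: of_counts_def)

lemma of_counts_Suc [simp]: "of_counts (Suc N) c = replicate (c (Suc N)) (Suc N) @ of_counts N c"
  by (simp add: of_counts_def)

lemma set_of_counts: "set (of_counts N c) \<subseteq> {1..N}"
  by (induction N) auto

lemma of_counts_in_parts_wrt: "of_counts N c \<in> parts_wrt dominates"
proof (induction N)
  case (Suc N)
  have "sorted_wrt dominates (replicate k x)" for k x :: nat
    by (induction k) auto
  then show ?case
    using Suc set_of_counts[of N c] by (fastforce simp: parts_wrt_def sorted_wrt_append)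
qed (simp add: parts_wrt_def)

lemma count_list_replicate: "count_list (replicate m x) k = (if k = x then m else 0)"
  by (induction m) auto

lemma count_list_of_counts: "count_list (of_counts N c) k = (if 1 \<le> k \<and> k \<le> N then c k else 0)"
  by (induction N) (auto simp: count_list_replicate le_Suc_eq)

lemma count_list_eq_0: "x \<notin> set xs \<Longrightarrow> count_list xs x = 0"
  by (simp add: count_list_0_iff)

lemma of_counts_count_list:
  assumes "xs \<in> parts_wrt dominates" "\<forall>x\<in>set xs. x \<le> N"
  shows "of_counts N (count_list xs) = xs"
proof (rule partition_eqI[OF of_counts_in_parts_wrt assms(1)])
  fix k
  have "count_list xs k = 0" if "\<not> (1 \<le> k \<and> k \<le> N)"
    using that assms by (intro count_list_eq_0) (auto simp: parts_wrt_def not_less_eq_eq)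
  then show "count_list (of_counts N (count_list xs)) k = count_list xs k"
    by (auto simp: count_list_of_counts)
qed

text \<open>Two equal adjacent parts cancel in the alternating sum, and even parts are not counted
  by \<open>odd_parts\<close>; so multiplicities of even parts matter only modulo 2.\<close>

lemma half_srank_of_counts_cong:
  assumes "\<And>k. even (c k) = even (c' k)" "\<And>k. odd k \<Longrightarrow> c k = c' k"
  shows "half_srank (of_counts N c) = half_srank (of_counts N c')"
proof -
  have "alt_sum (of_counts N c) = alt_sum (of_counts N c') \<and> odd_parts (of_counts N c) = odd_parts (of_counts N c')"
  proof (induction N)
    case (Suc N)
    then show ?case
      using assms(1)[of "Suc N"] assms(2)[of "Suc N"]
      by (cases "even (c (Suc N))")
         (auto simp: alt_sum_append alt_sum_replicate odd_parts_append odd_parts_replicate)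
  qed simp
  then show ?thesis by (simp add: half_srank_def)
qed

lemma sum_list_eq_sum_count:
  assumes "\<forall>x\<in>set xs. x \<le> N"
  shows "sum_list xs = (\<Sum>k\<le>N. k * count_list xs k)"
proof -
  have "sum_list (map (\<lambda>x. x) xs) = (\<Sum>k\<in>set xs. count_list xs k * k)"
    by (rule sum_list_map_eq_sum_count)
  also have "\<dots> = (\<Sum>k\<le>N. count_list xs k * k)"
    by (rule sum.mono_neutral_left) (use assms in \<open>auto simp: count_list_eq_0\<close>)
  finally show ?thesis by (simp add: mult.commute)
qed

lemma sum_even_indices: "(\<Sum>k\<le>2 * N. if even k then f k else 0) = (\<Sum>k\<le>N. f (2 * k :: nat) :: nat)"
  by (induction N) auto

definition nonrep_even :: "nat list set" where
  "nonrep_even = {xs \<in> parts_wrt dominates. \<forall>k. even k \<longrightarrow> count_list xs k \<le> 1}"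

definition pi2 :: "nat list \<Rightarrow> nat list" where
  "pi2 xs = of_counts (largest xs) (\<lambda>k. if even k then count_list xs k mod 2 else count_list xs k)"

lemma pi1_eq: "pi1 xs = of_counts (largest xs) (\<lambda>k. count_list xs (2 * k) div 2)"
  by (simp add: pi1_def of_counts_def)

lemma count_list_gt_largest: "largest xs < k \<Longrightarrow> count_list xs k = 0"
  using le_largest[of k xs] by (intro count_list_eq_0) auto

lemma count_list_pi1: "count_list (pi1 xs) k = (if k = 0 then 0 else count_list xs (2 * k) div 2)"
  using count_list_gt_largest[of xs "2 * k"] by (auto simp: pi1_eq count_list_of_counts)

lemma count_list_pos_0: "xs \<in> parts_wrt R \<Longrightarrow> count_list xs 0 = 0"
  by (intro count_list_eq_0) (auto simp: parts_wrt_def)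

lemma count_list_pi2:
  "xs \<in> parts_wrt R \<Longrightarrow> count_list (pi2 xs) k = (if even k then count_list xs k mod 2 else count_list xs k)"
  using count_list_gt_largest[of xs k] count_list_pos_0[of xs R]
  by (cases "k = 0") (auto simp: pi2_def count_list_of_counts)

lemma half_srank_pi2:
  assumes "xs \<in> parts_wrt dominates"
  shows "half_srank (pi2 xs) = half_srank xs"
proof -
  have "half_srank (of_counts (largest xs) (count_list xs)) = half_srank (pi2 xs)"
    unfolding pi2_def by (rule half_srank_of_counts_cong) auto
  then show ?thesis
    using of_counts_count_list[OF assms, of "largest xs"] le_largest by simp
qed

text \<open>Two parts 2k have 4k cells together and are recorded by a single part k of
  \<open>pi1\<close>.\<close>

lemma sum_list_pi1_pi2:
  assumes "xs \<in> parts_wrt dominates"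
  shows "4 * sum_list (pi1 xs) + sum_list (pi2 xs) = sum_list xs"
proof -
  let ?N = "largest xs" and ?c = "count_list xs"
  have le: "\<forall>x\<in>set (pi1 xs). x \<le> ?N" "\<forall>x\<in>set (pi2 xs). x \<le> 2 * ?N" "\<forall>x\<in>set xs. x \<le> 2 * ?N"
    using set_of_counts le_largest unfolding pi1_eq pi2_def by fastforce+
  have "4 * sum_list (pi1 xs) = (\<Sum>k\<le>?N. 2 * (2 * k) * (?c (2 * k) div 2))"
    unfolding sum_list_eq_sum_count[OF le(1)] sum_distrib_left
    by (intro sum.cong) (auto simp: count_list_pi1)
  also have "\<dots> = (\<Sum>k\<le>2 * ?N. if even k then 2 * k * (?c k div 2) else 0)"
    by (rule sum_even_indices[symmetric])
  finally have "4 * sum_list (pi1 xs) + sum_list (pi2 xs) = (\<Sum>k\<le>2 * ?N.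
      (if even k then 2 * k * (?c k div 2) else 0) + k * (if even k then ?c k mod 2 else ?c k))"
    by (simp add: sum_list_eq_sum_count[OF le(2)] count_list_pi2[OF assms] sum.distrib)
  also have "\<dots> = (\<Sum>k\<le>2 * ?N. k * ?c k)"
  proof (rule sum.cong)
    fix k
    have "2 * k * (?c k div 2) + k * (?c k mod 2) = k * (2 * (?c k div 2) + ?c k mod 2)"
      by (simp only: distrib_left mult_ac)
    also have "\<dots> = k * ?c k"
      by (simp only: mult_div_mod_eq)
    finally show "(if even k then 2 * k * (?c k div 2) else 0) + k * (if even k then ?c k mod 2 else ?c k) = k * ?c k"
      by simp
  qed simp
  finally show ?thesis
    by (simp add: sum_list_eq_sum_count[OF le(3)])
qed

text \<open>The multiplicity of an even number is recovered from its quotient and remainder modulo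
  2, kept in \<open>pi1\<close> and \<open>pi2\<close>; odd parts stay in \<open>pi2\<close>
  unchanged.\<close>

lemma bij_pi1_pi2:
  "bij_betw (\<lambda>xs. (pi1 xs, pi2 xs)) (parts_wrt dominates) (parts_wrt dominates \<times> nonrep_even)"
proof (rule bij_betwI')
  fix xs ys assume xs: "xs \<in> parts_wrt dominates" and ys: "ys \<in> parts_wrt dominates"
  show "((pi1 xs, pi2 xs) = (pi1 ys, pi2 ys)) = (xs = ys)"
  proof safe
    assume eq: "pi1 xs = pi1 ys" "pi2 xs = pi2 ys"
    show "xs = ys"
    proof (rule partition_eqI[OF xs ys])
      fix k
      have 2: "(if even k then count_list xs k mod 2 else count_list xs k)
          = (if even k then count_list ys k mod 2 else count_list ys k)"
        using eq(2) count_list_pi2[OF xs, of k] count_list_pi2[OF ys, of k] by simp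
      show "count_list xs k = count_list ys k"
      proof (cases "even k")
        case True
        then obtain j where k: "k = 2 * j" by blast
        then have "count_list xs k div 2 = count_list ys k div 2"
          using eq(1) count_list_pi1[of xs j] count_list_pi1[of ys j] count_list_pos_0[OF xs] count_list_pos_0[OF ys]
          by (cases "j = 0") auto
        then show ?thesis
          using 2 True by (metis div_mult_mod_eq)
      qed (use 2 in simp)
    qed
  qed
next
  fix xs :: "nat list" assume xs: "xs \<in> parts_wrt dominates"
  then show "(pi1 xs, pi2 xs) \<in> parts_wrt dominates \<times> nonrep_even"
    using count_list_pi2[OF xs] of_counts_in_parts_wrt
    by (auto simp: nonrep_even_def pi1_eq) (simp add: pi2_def of_counts_in_parts_wrt)
next
  fix p assume "p \<in> parts_wrt dominates \<times> nonrep_even"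
  then obtain a b where p: "p = (a, b)" and a: "a \<in> parts_wrt dominates" and b: "b \<in> parts_wrt dominates"
    and b2: "\<And>k. even k \<Longrightarrow> count_list b k \<le> 1"
    by (auto simp: nonrep_even_def)
  define c where "c k = (if even k then 2 * count_list a (k div 2) + count_list b k else count_list b k)" for k
  define xs where "xs = of_counts (2 * largest a + largest b) c"
  have xs: "xs \<in> parts_wrt dominates"
    unfolding xs_def by (rule of_counts_in_parts_wrt)
  have cnt: "count_list xs k = c k" for k
  proof (cases "1 \<le> k \<and> k \<le> 2 * largest a + largest b")
    case False
    then consider "k = 0" | "2 * largest a < k" "largest b < k" by linarith
    then have "c k = 0"
    proof cases
      case 2
      then have "largest a < k div 2" if "even k" using that by auto
      then show ?thesis
        using 2 by (auto simp: c_def count_list_gt_largest)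
    qed (use a b in \<open>simp add: c_def count_list_pos_0\<close>)
    then show ?thesis using False by (simp add: xs_def count_list_of_counts)
  qed (simp add: xs_def count_list_of_counts)
  have "pi1 xs = a"
  proof (rule partition_eqI[OF _ a])
    show "pi1 xs \<in> parts_wrt dominates"
      unfolding pi1_eq by (rule of_counts_in_parts_wrt)
    fix k
    have "count_list b (2 * k) div 2 = 0" using b2[of "2 * k"] by auto
    then show "count_list (pi1 xs) k = count_list a k"
      using count_list_pos_0[OF a] b2[of "2 * k"] by (auto simp: count_list_pi1 cnt c_def)
  qed
  moreover have "pi2 xs = b"
  proof (rule partition_eqI[OF _ b])
    show "pi2 xs \<in> parts_wrt dominates"
      unfolding pi2_def by (rule of_counts_in_parts_wrt)
    fix k
    show "count_list (pi2 xs) k = count_list b k"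
      using b2[of k] by (auto simp: count_list_pi2[OF xs] cnt c_def)
  qed
  ultimately show "\<exists>xs\<in>parts_wrt dominates. p = (pi1 xs, pi2 xs)"
    using xs p by auto
qed

lemma gf_pi1_half_srank:
  fixes z :: "'a :: field" and g :: "nat list \<Rightarrow> 'a"
  shows "gf (parts_wrt dominates) sum_list (\<lambda>xs. g (pi1 xs) * z powi half_srank xs)
    = gf (parts_wrt dominates) (\<lambda>xs. 4 * sum_list xs) g * gf nonrep_even sum_list (\<lambda>xs. z powi half_srank xs)"
proof -
  have "gf (parts_wrt dominates \<times> nonrep_even) (\<lambda>(a, b). 4 * sum_list a + sum_list b) (\<lambda>(a, b). g a * z powi half_srank b)
      = fps_const 1 * fps_X ^ 0 * gf (parts_wrt dominates) sum_list (\<lambda>xs. g (pi1 xs) * z powi half_srank xs)"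
    by (rule gf_reindex[OF bij_pi1_pi2]) (simp_all add: sum_list_pi1_pi2 half_srank_pi2)
  moreover have "finite {a. a \<in> parts_wrt dominates \<and> 4 * sum_list a = n}" for n
    by (intro finite_fibre parts_wrt_pos) simp
  moreover have "finite {a. a \<in> nonrep_even \<and> sum_list a = n}" for n
    using finite_fibre[of nonrep_even 1 n] parts_wrt_pos(1)[of dominates] by (auto simp: nonrep_even_def)
  ultimately show ?thesis
    by (simp add: gf_Times[symmetric])
qed

section \<open>Partitions of type B as hook enlargements\<close>

lemma part_conj:
  assumes "1 \<le> j"
  shows "part (conj xs) j = length (filter (\<lambda>x. j \<le> x) xs)"
proof (cases "j \<le> largest xs")
  case True
  then have "conj xs ! (j - 1) = length (filter (\<lambda>x. j \<le> x) xs)"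
    using assms by (cases j) (simp_all add: conj_def del: upt_Suc)
  then show ?thesis
    using True assms by (simp add: Defs.part_def) (simp add: conj_def)
next
  case False
  then have "filter (\<lambda>x. j \<le> x) xs = []"
    using le_largest[of _ xs] by (fastforce simp: filter_empty_conv)
  then show ?thesis
    using False by (simp add: Defs.part_def conj_def)
qed

text \<open>A part 1 is a row that meets the first column but not the second. The corresponding
  clause of type B thus asks for at least two parts 1.\<close>

lemma part_conj_diff: "int (part (conj xs) 1) - int (part (conj xs) 2) = int (count_list xs 1)"
proof -
  have "length (filter (\<lambda>x. 1 \<le> x) xs) = length (filter (\<lambda>x. 2 \<le> x) xs) + count_list xs 1"
    by (induction xs) auto
  then show ?thesis by (simp add: part_conj)
qed

lemma partition_split_ones:
  assumes "xs \<in> parts_wrt dominates"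
  shows "xs = filter (\<lambda>x. 2 \<le> x) xs @ replicate (count_list xs 1) 1"
  using assms
proof (induction xs)
  case (Cons x xs)
  then have IH: "xs = filter (\<lambda>x. 2 \<le> x) xs @ replicate (count_list xs 1) 1"
    by (simp add: parts_wrt_def)
  show ?case
  proof (cases "2 \<le> x")
    case True
    then show ?thesis using IH by simp
  next
    case False
    then have x: "x = 1" using Cons.prems by (simp add: parts_wrt_def)
    then have "filter (\<lambda>x. 2 \<le> x) xs = []"
      using Cons.prems by (fastforce simp: filter_empty_conv parts_wrt_def)
    then show ?thesis using IH x by simp
  qed
qed simp

text \<open>Two cells are added to the first row and two to the first column. The empty partition
  goes to the exceptional partition of type B.\<close>

fun add_hook :: "nat list \<Rightarrow> nat list" where
  "add_hook [] = [3, 1]"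
| "add_hook (x # xs) = (x + 2) # xs @ [1, 1]"

text \<open>The longer first row keeps its parity and adds 2 to the alternating sum; the two new
  ones are two odd parts that cancel in the alternating sum.\<close>

lemma half_srank_add_hook: "half_srank (add_hook xs) = half_srank xs"
proof (cases xs)
  case (Cons x ys)
  show ?thesis
    unfolding Cons
    by (rule half_srank_eqI, cases "even (length ys)") (simp_all add: alt_sum_append odd_parts_def)
qed (simp add: half_srank_def odd_parts_def)

text \<open>The first gap grows by 2 and two ones appear. The excluded case of equal even numbers
  cannot occur, because undoing the hook returns \<open>xs\<close>, where no even part is
  repeated.\<close>

lemma typeB_add_hook:
  assumes "xs \<in> nonrep_even"
  shows "add_hook xs \<in> {xs \<in> parts_wrt dominates. typeB xs}"
proof (cases xs)
  case Nil
  then show ?thesis by (simp add: typeB_def parts_wrt_def)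
next
  case (Cons x ys)
  have x: "0 < x" "\<forall>y\<in>set ys. y \<le> x" "\<forall>y\<in>set ys. 0 < y" "sorted_wrt dominates ys"
    and cnt: "\<And>k. even k \<Longrightarrow> count_list xs k \<le> 1"
    using assms by (auto simp: nonrep_even_def parts_wrt_def Cons)
  let ?h = "hd (ys @ [1, 1])"
  have parts: "part (add_hook xs) 1 = x + 2" "part (add_hook xs) 2 = ?h"
    by (simp_all add: Defs.part_def Cons hd_conv_nth)
  have "?h \<in> set (ys @ [1, 1])" by (rule hd_in_set) simp
  then have "?h \<le> x" using x by auto
  moreover have "\<not> (x = ?h \<and> even ?h)"
  proof safe
    assume h: "x = ?h" "even ?h"
    then obtain y zs where ys: "ys = y # zs" by (cases ys) auto
    then show False using h cnt[of x] by (simp add: Cons)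
  qed
  moreover have "2 \<le> count_list (add_hook xs) 1"
    by (simp add: Cons)
  moreover have "count_list (add_hook xs) k \<le> 1" if "even k" for k
  proof -
    have "k \<noteq> 1" using that by auto
    moreover have "k = x + 2 \<Longrightarrow> count_list ys k = 0" using x by (intro count_list_eq_0) auto
    ultimately show ?thesis using cnt[OF that] by (auto simp: Cons split: if_splits)
  qed
  ultimately have "typeB (add_hook xs)"
    unfolding typeB_def part_conj_diff parts using x(1) by (auto simp: Cons)
  then show ?thesis
    using x by (auto simp: Cons parts_wrt_def sorted_wrt_append Suc_le_eq)
qed

text \<open>Two ones and a first gap of at least 2 leave room to remove the hook. A repeated even
  part could arise only if the shortened first part equals the second, which is the case that type B
  excludes.\<close>

lemma typeB_eq_add_hook:
  assumes xs: "xs \<in> parts_wrt dominates" and B: "typeB xs"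
  shows "\<exists>ys\<in>nonrep_even. xs = add_hook ys"
proof (cases "xs = [3, 1]")
  case True
  then show ?thesis
    by (intro bexI[of _ "[]"]) (simp_all add: nonrep_even_def parts_wrt_def)
next
  case False
  define F j where "F = filter (\<lambda>x. 2 \<le> x) xs" and "j = count_list xs 1"
  have split: "xs = F @ replicate j 1"
    unfolding F_def j_def by (rule partition_split_ones[OF xs])
  have diff: "part xs 2 + 2 \<le> part xs 1" and j: "2 \<le> j"
    and ne: "\<not> (int (part xs 1) - 2 = int (part xs 2) \<and> even (part xs 2))"
    and cnt: "\<And>k. even k \<Longrightarrow> count_list xs k \<le> 1"
    using B False part_conj_diff[of xs] by (auto simp: typeB_def j_def)
  obtain i where i: "j = Suc (Suc i)" using j by (metis add_2_eq_Suc le_Suc_ex)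
  have rep: "replicate j (1::nat) = replicate i 1 @ [1, 1]"
    unfolding i by (induction i) simp_all
  \<comment> \<open>If all parts were 1, the first two would be equal, against the gap.\<close>
  obtain y F' where F: "F = y # F'"
    using diff split i by (cases F) (auto simp: Defs.part_def)
  define r where "r = F' @ replicate i 1"
  have eq: "xs = y # r @ [1, 1]"
    unfolding split F r_def rep by simp
  let ?h = "hd (r @ [1, 1])"
  have parts: "part xs 1 = y" "part xs 2 = ?h"
    by (simp_all add: Defs.part_def eq hd_conv_nth)
  have srt: "sorted_wrt dominates (r @ [1, 1])" "\<forall>x\<in>set r. 0 < x"
    using xs by (auto simp: eq parts_wrt_def)
  have h: "\<forall>x\<in>set (r @ [1, 1]). x \<le> ?h"
    using srt(1) by (cases r) auto
  then have "1 \<le> ?h" by simp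
  then have y: "?h \<le> y - 2" "0 < y - 2" "2 \<le> y"
    using diff unfolding parts by auto
  have "(y - 2) # r \<in> nonrep_even"
  proof -
    have "count_list ((y - 2) # r) k \<le> 1" if "even k" for k
    proof (cases "k = y - 2")
      case True
      have "k \<notin> set r"
      proof
        assume "k \<in> set r"
        then have "?h = y - 2" using h y True by (auto intro: antisym)
        then show False using ne that True y unfolding parts by auto
      qed
      then show ?thesis by (simp add: count_list_eq_0)
    next
      case False
      then show ?thesis using cnt[OF that] by (auto simp: eq split: if_splits)
    qed
    moreover have "\<forall>x\<in>set r. x \<le> y - 2" using h y by auto
    ultimately show ?thesis
      using srt y by (auto simp: nonrep_even_def parts_wrt_def sorted_wrt_append)
  qed
  moreover have "xs = add_hook ((y - 2) # r)"
    using y by (simp add: eq)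
  ultimately show ?thesis by blast
qed

lemma gf_typeB:
  fixes z :: "'a :: field"
  shows "gf {xs \<in> parts_wrt dominates. typeB xs} sum_list (\<lambda>xs. z powi half_srank xs)
    = fps_X ^ 4 * gf nonrep_even sum_list (\<lambda>xs. z powi half_srank xs)"
proof -
  have bij: "bij_betw add_hook nonrep_even {xs \<in> parts_wrt dominates. typeB xs}"
  proof (rule bij_betw_imageI)
    show "inj_on add_hook nonrep_even"
    proof (rule inj_onI)
      fix xs ys assume "add_hook xs = add_hook ys"
      then show "xs = ys"
        by (cases xs; cases ys) auto
    qed
    show "add_hook ` nonrep_even = {xs \<in> parts_wrt dominates. typeB xs}"
      using typeB_add_hook typeB_eq_add_hook by blast
  qed
  have "gf {xs \<in> parts_wrt dominates. typeB xs} sum_list (\<lambda>xs. z powi half_srank xs)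
    = fps_const 1 * fps_X ^ 4 * gf nonrep_even sum_list (\<lambda>xs. z powi half_srank xs)"
  proof (rule gf_reindex[OF bij])
    show "sum_list (add_hook xs) = 4 + sum_list xs" for xs
      by (cases xs) auto
  qed (simp add: half_srank_add_hook)
  then show ?thesis by simp
qed

section \<open>The crank\<close>

lemma gf_restrict:
  assumes "\<And>n. finite {a. a \<in> A \<and> sz a = n}"
  shows "gf {a \<in> A. P a} sz wt = gf A sz (\<lambda>a. if P a then wt a else 0)"
proof (rule fps_ext)
  fix n
  have "{a. a \<in> {a \<in> A. P a} \<and> sz a = n} = {a \<in> {a. a \<in> A \<and> sz a = n}. P a}"
    by auto
  then show "gf {a \<in> A. P a} sz wt $ n = gf A sz (\<lambda>a. if P a then wt a else 0) $ n"
    unfolding gf_nth using sum.inter_filter[OF assms[of n], of wt P] by simp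
qed

lemma gf_eq_fps_sums:
  assumes fin: "\<And>n. finite {a. a \<in> A \<and> sz a = n}" and cl: "\<And>a. a \<in> A \<Longrightarrow> cl a \<le> sz a"
  shows "gf A sz wt = fps_sums (\<lambda>i. gf {a \<in> A. cl a = i} sz wt)"
proof (rule fps_ext)
  fix n
  have "(\<Sum>i\<le>n. \<Sum>a | a \<in> {a. a \<in> A \<and> sz a = n} \<and> cl a = i. wt a) = (\<Sum>a | a \<in> A \<and> sz a = n. wt a)"
    using sum.group[OF fin[of n] finite_atMost[of n], of cl wt] cl by auto
  moreover have "{a. a \<in> {a. a \<in> A \<and> sz a = n} \<and> cl a = i} = {a. a \<in> {a \<in> A. cl a = i} \<and> sz a = n}" for i
    by auto
  ultimately show "gf A sz wt $ n = fps_sums (\<lambda>i. gf {a \<in> A. cl a = i} sz wt) $ n"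
    by (simp add: fps_sums_def gf_nth)
qed

text \<open>This counts what is left in one crank class after the largest part or all ones have been
  removed. Weight 0 forbids the part 1, parts up to \<open>Suc i\<close> count plainly, and the
  larger ones, which the crank counts, carry \<open>x\<close>.\<close>

lemma gf_no_ones:
  fixes x :: "'a :: field" and r i :: nat
  assumes r: "0 < r"
  defines "Q \<equiv> fps_X ^ r :: 'a fps"
    and "wt \<equiv> \<lambda>ys. if 1 \<in> set ys then 0 else x ^ length (filter (\<lambda>y. Suc i < y) ys)"
  shows "gf (parts_wrt_le dominates (Suc i)) (\<lambda>xs. r * sum_list xs) wt * qpoch (Q\<^sup>2) Q i = 1"
    and "gf (parts_wrt dominates) (\<lambda>xs. r * sum_list xs) wt * qpoch (Q\<^sup>2) Q i
      * qinf (fps_const x * Q ^ (i + 2)) Q = 1"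
proof -
  let ?P = "\<lambda>N. gf (parts_wrt_le dominates N) (\<lambda>xs. r * sum_list xs) wt"
  \<comment> \<open>The part 1 (\<open>N = 0\<close>) has weight 0, so its geometric series is
    trivial and the products start at Q^2.\<close>
  have step: "(1 - fps_const c * Q ^ Suc N) * ?P (Suc N) = ?P N"
    if "c = (if N = 0 then 0 else if Suc N \<le> Suc i then 1 else x)" for N c
    unfolding Q_def power_mult[symmetric]
    by (rule gf_parts_wrt_le_Suc_repeat[OF _ _ r]) (auto simp: wt_def that)
  have P1: "?P (Suc 0) = 1"
    using step[of 0 0] gf_parts_wrt_le_0[of wt dominates "\<lambda>xs. r * sum_list xs"] by (simp add: wt_def)
  have small: "?P (Suc k) * qpoch (Q\<^sup>2) Q k = 1" if "k \<le> i" for k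
    using that
  proof (induction k)
    case (Suc k)
    have e: "Q\<^sup>2 * Q ^ k = Q ^ Suc (Suc k)" by (simp add: power2_eq_square mult.assoc)
    have "?P (Suc (Suc k)) * qpoch (Q\<^sup>2) Q (Suc k)
        = ((1 - fps_const 1 * Q ^ Suc (Suc k)) * ?P (Suc (Suc k))) * qpoch (Q\<^sup>2) Q k"
      unfolding qpoch_Suc e by (simp only: fps_const_1_eq_1 mult_1_left mult_ac)
    also have "(1 - fps_const 1 * Q ^ Suc (Suc k)) * ?P (Suc (Suc k)) = ?P (Suc k)"
      by (rule step) (use Suc.prems in simp)
    also have "?P (Suc k) * qpoch (Q\<^sup>2) Q k = 1"
      using Suc by simp
    finally show ?case .
  qed (simp add: P1)
  then show "?P (Suc i) * qpoch (Q\<^sup>2) Q i = 1" by simp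
  have large: "?P (Suc i + M) * qpoch (Q\<^sup>2) Q i * qpoch (fps_const x * Q ^ (i + 2)) Q M = 1" for M
  proof (induction M)
    case (Suc M)
    have e: "fps_const x * Q ^ (i + 2) * Q ^ M = fps_const x * Q ^ Suc (Suc i + M)"
      by (simp add: mult.assoc flip: power_add)
    have "?P (Suc i + Suc M) * qpoch (Q\<^sup>2) Q i * qpoch (fps_const x * Q ^ (i + 2)) Q (Suc M)
        = ((1 - fps_const x * Q ^ Suc (Suc i + M)) * ?P (Suc (Suc i + M))) * qpoch (Q\<^sup>2) Q i
          * qpoch (fps_const x * Q ^ (i + 2)) Q M"
      unfolding qpoch_Suc e add_Suc_right by (simp only: mult_ac)
    also have "(1 - fps_const x * Q ^ Suc (Suc i + M)) * ?P (Suc (Suc i + M)) = ?P (Suc i + M)"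
      by (rule step) simp
    also note Suc
    finally show ?case .
  qed (simp add: small)
  have Q0: "Q $ 0 = 0" using r by (simp add: Q_def)
  have "(\<lambda>M. ?P (Suc i + M)) \<longlonglongrightarrow> gf (parts_wrt dominates) (\<lambda>xs. r * sum_list xs) wt"
    using LIMSEQ_ignore_initial_segment[OF gf_parts_wrt_le_tendsto[OF r, of dominates wt], of "Suc i"]
    by (simp add: add.commute)
  then have "(\<lambda>M. ?P (Suc i + M) * qpoch (Q\<^sup>2) Q i * qpoch (fps_const x * Q ^ (i + 2)) Q M)
    \<longlonglongrightarrow> gf (parts_wrt dominates) (\<lambda>xs. r * sum_list xs) wt * qpoch (Q\<^sup>2) Q i * qinf (fps_const x * Q ^ (i + 2)) Q"
    by (intro tendsto_mult_fps tendsto_const qpoch_tendsto_qinf Q0)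
  then show "gf (parts_wrt dominates) (\<lambda>xs. r * sum_list xs) wt * qpoch (Q\<^sup>2) Q i * qinf (fps_const x * Q ^ (i + 2)) Q = 1"
    unfolding large by (simp add: tendsto_const_iff)
qed

lemma largest_Cons_eq: "\<forall>y\<in>set ys. y \<le> x \<Longrightarrow> largest (x # ys) = x"
  by (rule antisym) (auto simp: largest_le_iff intro: le_largest)

lemma largest_le_sum_list: "largest xs \<le> sum_list xs"
  unfolding largest_le_iff by (auto intro: member_le_sum_list)

lemma count_list_le_sum_list: "count_list xs 1 \<le> sum_list xs"
  by (induction xs) auto

text \<open>In class i the crank is i for a partition without ones, and otherwise the number of
  parts above i, minus i.\<close>

definition crank_class :: "nat list \<Rightarrow> nat" where
  "crank_class xs = (if count_list xs 1 = 0 then largest xs else count_list xs 1)"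

text \<open>Without ones, remove one largest part; with ones, remove all ones. For
  \<open>i = 0\<close> the first kind is empty, since a partition with largest part 1 has ones; this
  missing term is one source of the defect in the crank product.\<close>

lemma gf_crank_class:
  fixes x :: "'a :: field" and r i :: nat
  assumes r: "0 < r" and x: "x \<noteq> 0"
  defines "Q \<equiv> fps_X ^ r :: 'a fps"
    and "C \<equiv> \<lambda>i. {xs \<in> parts_wrt dominates. crank_class xs = i}"
    and "wt \<equiv> \<lambda>i ys. if 1 \<in> set ys then 0 else x ^ length (filter (\<lambda>y. i < y) ys)"
  shows "gf (C 0) (\<lambda>xs. r * sum_list xs) (\<lambda>xs. x powi crank xs) = 1"
    and "gf (C (Suc i)) (\<lambda>xs. r * sum_list xs) (\<lambda>xs. x powi crank xs)
      = (if i = 0 then 0 else (fps_const x * Q) ^ Suc i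
          * gf (parts_wrt_le dominates (Suc i)) (\<lambda>xs. r * sum_list xs) (wt (Suc i)))
        + (fps_const (inverse x) * Q) ^ Suc i * gf (parts_wrt dominates) (\<lambda>xs. r * sum_list xs) (wt (Suc i))"
proof -
  let ?sz = "\<lambda>xs. r * sum_list xs" and ?cw = "\<lambda>xs. x powi crank xs"
  have fin: "finite {xs. xs \<in> A \<and> r * sum_list xs = n}" if "A \<subseteq> parts_wrt dominates" for A n
    using that parts_wrt_pos(1) by (intro finite_fibre r) blast
  have pow: "(fps_const y * Q) ^ k = fps_const (y ^ k) * fps_X ^ (r * k)" for y k
    by (simp only: Q_def power_mult_distrib power_mult fps_const_power)
  have C0: "C 0 = {[]}"
  proof -
    have "xs = []" if "xs \<in> C 0" for xs
    proof (rule ccontr)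
      assume "xs \<noteq> []"
      then have "hd xs \<in> set xs" by simp
      then have "0 < largest xs" using that le_largest[of "hd xs" xs] by (fastforce simp: C_def parts_wrt_def)
      then show False using that by (auto simp: C_def crank_class_def split: if_splits)
    qed
    moreover have "[] \<in> C 0" by (simp add: C_def crank_class_def parts_wrt_def largest_def)
    ultimately show ?thesis by blast
  qed
  have "{xs. xs \<in> C 0 \<and> ?sz xs = n} = (if n = 0 then {[]} else {})" for n
    unfolding C0 by auto
  then have "gf (C 0) ?sz ?cw $ n = (if n = 0 then 1 else 0)" for n
    by (simp add: gf_nth crank_def largest_def)
  then show "gf (C 0) ?sz ?cw = 1"
    by (simp add: fps_eq_iff)
  define A B where "A = {xs \<in> C (Suc i). count_list xs 1 = 0}" and "B = {xs \<in> C (Suc i). count_list xs 1 \<noteq> 0}"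
  have sub: "A \<subseteq> parts_wrt dominates" "B \<subseteq> parts_wrt dominates"
    by (auto simp: A_def B_def C_def)
  have "C (Suc i) = A \<union> B" by (auto simp: A_def B_def)
  moreover have "A \<inter> B = {}" by (auto simp: A_def B_def)
  ultimately have AB: "gf (C (Suc i)) ?sz ?cw = gf A ?sz ?cw + gf B ?sz ?cw"
    using gf_Un_disjoint[OF _ fin[OF sub(1)] fin[OF sub(2)], of ?cw] by simp
  have A: "gf A ?sz ?cw = (if i = 0 then 0 else (fps_const x * Q) ^ Suc i
      * gf (parts_wrt_le dominates (Suc i)) ?sz (wt (Suc i)))"
  proof (cases "i = 0")
    case True
    have "xs \<notin> A" for xs
    proof
      assume "xs \<in> A"
      then have xs: "xs \<in> parts_wrt dominates" "largest xs = 1" "1 \<notin> set xs"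
        using True by (auto simp: A_def C_def crank_class_def count_list_0_iff)
      then have "\<forall>y\<in>set xs. y = 1" using le_largest[of _ xs] by (fastforce simp: parts_wrt_def)
      then have "xs = []" using xs(3) by (cases xs) auto
      then show False using xs(2) by (simp add: largest_def)
    qed
    then have "A = {}" by blast
    then show ?thesis using True by (simp add: gf_def fps_eq_iff)
  next
    case False
    let ?D = "{ys \<in> parts_wrt_le dominates (Suc i). 1 \<notin> set ys}"
    have bij: "bij_betw (Cons (Suc i)) ?D A"
    proof (rule bij_betw_imageI)
      show "Cons (Suc i) ` ?D = A"
      proof safe
        fix ys assume ys: "ys \<in> parts_wrt_le dominates (Suc i)" "1 \<notin> set ys"
        then have "largest (Suc i # ys) = Suc i"
          by (intro largest_Cons_eq) (simp add: parts_wrt_le_def)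
        then show "Suc i # ys \<in> A"
          using ys False by (simp add: A_def C_def crank_class_def parts_wrt_le_def parts_wrt_def count_list_0_iff)
      next
        fix xs assume "xs \<in> A"
        then have xs: "xs \<in> parts_wrt dominates" "largest xs = Suc i" "1 \<notin> set xs"
          by (auto simp: A_def C_def crank_class_def count_list_0_iff)
        then obtain y ys where y: "xs = y # ys" by (cases xs) (auto simp: largest_def)
        have "largest xs = y"
          unfolding y by (rule largest_Cons_eq) (use xs(1) in \<open>simp add: y parts_wrt_def\<close>)
        then have "y = Suc i" using xs(2) by simp
        then show "xs \<in> Cons (Suc i) ` ?D"
          using xs by (auto simp: y parts_wrt_le_def parts_wrt_def)
      qed
    qed simp
    have "gf A ?sz ?cw = fps_const (x ^ Suc i) * fps_X ^ (r * Suc i) * gf ?D ?sz (wt (Suc i))"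
    proof (rule gf_reindex[OF bij])
      fix ys assume ys: "ys \<in> ?D"
      then have "Suc i # ys \<in> A" using bij by (auto simp: bij_betw_def)
      then have "crank (Suc i # ys) = int (Suc i)"
        by (auto simp: A_def C_def crank_class_def crank_def simp del: of_nat_Suc)
      moreover have "filter (\<lambda>y. Suc i < y) ys = []"
        using ys by (auto simp: filter_empty_conv parts_wrt_le_def)
      ultimately show "x powi crank (Suc i # ys) = x ^ Suc i * wt (Suc i) ys"
        using ys by (simp only: power_int_of_nat) (simp add: wt_def)
    qed (simp add: distrib_left)
    moreover have "gf ?D ?sz (wt (Suc i)) = gf (parts_wrt_le dominates (Suc i)) ?sz (wt (Suc i))"
    proof (subst gf_restrict)
      show "finite {a. a \<in> parts_wrt_le dominates (Suc i) \<and> ?sz a = n}" for n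
        by (rule fin) (auto simp: parts_wrt_le_def)
    qed (auto intro!: gf_cong simp: wt_def)
    ultimately show ?thesis
      using False by (simp only: pow if_False)
  qed
  have B: "gf B ?sz ?cw = (fps_const (inverse x) * Q) ^ Suc i * gf (parts_wrt dominates) ?sz (wt (Suc i))"
  proof -
    let ?D = "{ys \<in> parts_wrt dominates. 1 \<notin> set ys}"
    let ?f = "\<lambda>ys. ys @ replicate (Suc i) (1 :: nat)"
    have cnt: "count_list (?f ys) 1 = Suc i" if "1 \<notin> set ys" for ys
      using that by (simp add: count_list_replicate count_list_eq_0 del: replicate_Suc)
    have srt: "sorted_wrt dominates (replicate k (1 :: nat))" for k
      by (induction k) auto
    have bij: "bij_betw ?f ?D B"
    proof (rule bij_betw_imageI)
      show "inj_on ?f ?D" by (auto simp: inj_on_def)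
      show "?f ` ?D = B"
      proof safe
        fix ys assume ys: "ys \<in> parts_wrt dominates" "1 \<notin> set ys"
        have "?f ys \<in> parts_wrt dominates"
          using ys(1) srt[of "Suc i"] by (auto simp: parts_wrt_def sorted_wrt_append Suc_le_eq simp del: replicate_Suc)
        then show "?f ys \<in> B"
          using cnt[OF ys(2)] by (simp add: B_def C_def crank_class_def del: replicate_Suc)
      next
        fix xs assume xs: "xs \<in> B"
        then have xs': "xs \<in> parts_wrt dominates" "count_list xs 1 = Suc i"
          by (auto simp: B_def C_def crank_class_def)
        then have "xs = ?f (filter (\<lambda>x. 2 \<le> x) xs)"
          using partition_split_ones[OF xs'(1)] by (simp del: replicate_Suc)
        moreover have "filter (\<lambda>x. 2 \<le> x) xs \<in> ?D"
          using xs'(1) by (auto simp: parts_wrt_def sorted_wrt_filter)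
        ultimately show "xs \<in> ?f ` ?D" by blast
      qed
    qed
    have "gf B ?sz ?cw = fps_const (inverse x ^ Suc i) * fps_X ^ (r * Suc i) * gf ?D ?sz (wt (Suc i))"
    proof (rule gf_reindex[OF bij])
      fix ys assume ys: "ys \<in> ?D"
      show "r * sum_list (?f ys) = r * Suc i + r * sum_list ys"
        by (simp add: sum_list_replicate algebra_simps del: replicate_Suc)
      have "crank (?f ys) = int (length (filter (\<lambda>y. Suc i < y) ys)) - int (Suc i)"
        using cnt[of ys] ys by (simp add: crank_def del: replicate_Suc)
      then have "x powi crank (?f ys) = x ^ length (filter (\<lambda>y. Suc i < y) ys) / x ^ Suc i"
        using x by (simp only: power_int_diff power_int_of_nat simp_thms)
      then show "x powi crank (?f ys) = inverse x ^ Suc i * wt (Suc i) ys"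
        using ys by (simp add: wt_def divide_inverse power_inverse mult.commute del: replicate_Suc)
    qed
    moreover have "gf ?D ?sz (wt (Suc i)) = gf (parts_wrt dominates) ?sz (wt (Suc i))"
      by (subst gf_restrict) (auto intro!: fin gf_cong simp: wt_def)
    ultimately show ?thesis
      by (simp only: pow)
  qed
  show "gf (C (Suc i)) ?sz ?cw = (if i = 0 then 0 else (fps_const x * Q) ^ Suc i
        * gf (parts_wrt_le dominates (Suc i)) ?sz (wt (Suc i)))
      + (fps_const (inverse x) * Q) ^ Suc i * gf (parts_wrt dominates) ?sz (wt (Suc i))"
    unfolding AB A B ..
qed

text \<open>Summed over the classes, both kinds are q-binomial series up to the factor 1 - Q: in c =
  xQ with parameter 0, and in d = Q/x with parameter c. As c d = Q^2, the numerator of the second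
  product is free of \<open>x\<close>. The summand (x - 1) Q corrects the lowest classes.\<close>

theorem gf_crank:
  fixes x :: "'a :: field" and r :: nat
  assumes r: "0 < r" and x: "x \<noteq> 0"
  defines "Q \<equiv> fps_X ^ r :: 'a fps"
  shows "(gf (parts_wrt dominates) (\<lambda>xs. r * sum_list xs) (\<lambda>xs. x powi crank xs) + (fps_const x - 1) * Q)
      * qinf (fps_const x * Q) Q * qinf (fps_const (inverse x) * Q) Q = qinf Q Q"
proof -
  let ?sz = "\<lambda>xs. r * sum_list xs" and ?cw = "\<lambda>xs. x powi crank xs"
  define f where "f i = gf {xs \<in> parts_wrt dominates. crank_class xs = i} ?sz ?cw" for i
  define C where "C = gf (parts_wrt dominates) ?sz ?cw"
  define c d where "c = fps_const x * Q" and "d = fps_const (inverse x) * Q"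
  define E where "E = qinf c Q"
  define u v where "u i = qpoch 0 Q i * inverse (qpoch Q Q i) * c ^ i"
    and "v i = qpoch c Q i * inverse (qpoch Q Q i) * d ^ i" for i
  have Q0: "Q $ 0 = 0" using r by (simp add: Q_def)
  then have c0: "c $ 0 = 0" and d0: "d $ 0 = 0" by (simp_all add: c_def d_def)
  have poch0: "qpoch 0 Q i = 1" for i
    by (simp add: qpoch_def)
  have inv1: "(1 - Q) * inverse (1 - Q) = 1"
    using Q0 by (intro inverse_mult_eq_1') simp
  \<comment> \<open>The reciprocal of (Q^2; Q)_i becomes 1 - Q over (Q; Q)_(i+1), the shape required
    by the q-binomial theorem.\<close>
  have kappa: "P = (1 - Q) * inverse (qpoch Q Q (Suc i))" if "P * qpoch (Q\<^sup>2) Q i = 1" for P i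
  proof -
    have K: "qpoch Q Q (Suc i) = (1 - Q) * qpoch (Q\<^sup>2) Q i"
      by (simp add: qpoch_Suc_shift power2_eq_square)
    have "qpoch (Q\<^sup>2) Q i $ 0 = 1"
      using Q0 by (intro qpoch_nth_0) (simp add: power2_eq_square)
    then have "qpoch (Q\<^sup>2) Q i * inverse (qpoch (Q\<^sup>2) Q i) = 1"
      by (intro inverse_mult_eq_1') simp
    then have "P = P * qpoch (Q\<^sup>2) Q i * inverse (qpoch (Q\<^sup>2) Q i)"
      by (simp add: mult.assoc)
    also have "\<dots> = (1 - Q) * inverse (1 - Q) * inverse (qpoch (Q\<^sup>2) Q i)"
      unfolding that inv1 ..
    finally show ?thesis
      by (simp add: K fps_inverse_mult mult.assoc)
  qed
  define wt where "wt i ys = (if 1 \<in> set ys then 0 else x ^ length (filter (\<lambda>y. i < y) ys))" for i :: nat and ys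
  define PA PB where "PA i = gf (parts_wrt_le dominates (Suc i)) ?sz (wt (Suc i))"
    and "PB i = gf (parts_wrt dominates) ?sz (wt (Suc i))" for i
  have f0: "f 0 = 1"
    unfolding f_def by (rule gf_crank_class(1)[OF r x])
  have fS: "f (Suc i) = (if i = 0 then 0 else c ^ Suc i * PA i) + d ^ Suc i * PB i" for i
    unfolding f_def PA_def PB_def wt_def c_def d_def Q_def by (rule gf_crank_class(2)[OF r x])
  have PA: "PA i = (1 - Q) * inverse (qpoch Q Q (Suc i))" for i
    unfolding PA_def wt_def by (rule kappa, unfold Q_def, rule gf_no_ones(1)[OF r])
  have PB: "PB i * qinf (c * Q ^ Suc i) Q = (1 - Q) * inverse (qpoch Q Q (Suc i))" for i
  proof (rule kappa)
    have "c * Q ^ Suc i = fps_const x * Q ^ (i + 2)"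
      by (simp add: c_def mult_ac)
    then show "PB i * qinf (c * Q ^ Suc i) Q * qpoch (Q\<^sup>2) Q i = 1"
      using gf_no_ones(2)[OF r, where i = i and x = x] unfolding PB_def wt_def Q_def by (simp only: mult_ac)
  qed
  have EB: "E * (d ^ Suc i * PB i) = (1 - Q) * v (Suc i)" for i
  proof -
    have "E = qpoch c Q (Suc i) * qinf (c * Q ^ Suc i) Q"
      unfolding E_def by (rule qinf_qpoch_mult[OF Q0])
    then have "E * (d ^ Suc i * PB i) = qpoch c Q (Suc i) * d ^ Suc i * (PB i * qinf (c * Q ^ Suc i) Q)"
      by (simp only: mult_ac)
    then show ?thesis
      unfolding PB v_def by (simp only: mult_ac)
  qed
  have EA: "c ^ Suc i * PA i = (1 - Q) * u (Suc i)" for i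
    unfolding PA u_def poch0 by (simp only: mult_ac mult_1_left)
  have u01: "u 0 = 1" "(1 - Q) * u 1 = c" "v 0 = 1"
  proof -
    have "(1 - Q) * u 1 = (1 - Q) * inverse (1 - Q) * c"
      by (simp add: u_def poch0 qpoch_Suc mult.assoc)
    then show "(1 - Q) * u 1 = c" by (simp only: inv1 mult_1_left)
  qed (simp_all add: u_def v_def)
  \<comment> \<open>(1 - Q)(u 0 + u 1) equals 1 - Q + c, whereas class 0 gives 1 and class 1 has
    nothing without ones; hence the correction \<open>Q - c\<close>. The subtracted 1 is
    \<open>v 0\<close>, to which no class belongs.\<close>
  have partial: "E * (\<Sum>i\<le>Suc J. f i) = E * ((1 - Q) * (\<Sum>i\<le>Suc J. u i) + (Q - c)) + (1 - Q) * ((\<Sum>i\<le>Suc J. v i) - 1)" for J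
  proof (induction J)
    case 0
    have "f 1 = d ^ Suc 0 * PB 0" using fS[of 0] by simp
    then have "E * f 1 = (1 - Q) * v 1" using EB[of 0] by simp
    moreover have "(1 - Q) * (u 0 + u 1) + (Q - c) = 1"
      using u01 by (simp add: distrib_left)
    ultimately show ?case
      by (simp add: f0 u01(3) distrib_left)
  next
    case (Suc J)
    have "E * f (Suc (Suc J)) = E * ((1 - Q) * u (Suc (Suc J))) + (1 - Q) * v (Suc (Suc J))"
      using fS[of "Suc J"] EA[of "Suc J"] EB[of "Suc J"] by (simp add: distrib_left)
    with Suc show ?case
      unfolding sum.atMost_Suc[of _ "Suc J"] by algebra
  qed
  have lim_f: "(\<lambda>J. \<Sum>i\<le>J. f i) \<longlonglongrightarrow> C"
  proof -
    have fin: "finite {xs. xs \<in> parts_wrt dominates \<and> ?sz xs = n}" for n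
      by (intro finite_fibre r parts_wrt_pos)
    have cl: "crank_class xs \<le> ?sz xs" for xs
    proof -
      have "crank_class xs \<le> sum_list xs"
        using largest_le_sum_list[of xs] count_list_le_sum_list[of xs] by (simp add: crank_class_def)
      also have "\<dots> \<le> ?sz xs" using r by simp
      finally show ?thesis .
    qed
    have "C = fps_sums f"
      unfolding C_def f_def by (rule gf_eq_fps_sums[OF fin cl])
    moreover have "f j $ n = 0" if "n < j" for j n
    proof -
      have "{xs. xs \<in> {xs \<in> parts_wrt dominates. crank_class xs = j} \<and> ?sz xs = n} = {}"
      proof safe
        fix xs assume "j = crank_class xs" "n = ?sz xs"
        then show "xs \<in> {}" using that cl[of xs] by simp
      qed
      then show ?thesis unfolding f_def gf_nth by (simp only: sum.empty)
    qed
    ultimately show ?thesis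
      using fps_sums_tendsto[of f] by simp
  qed
  have lim_u: "(\<lambda>J. \<Sum>i\<le>J. u i) \<longlonglongrightarrow> fps_sums u" and lim_v: "(\<lambda>J. \<Sum>i\<le>J. v i) \<longlonglongrightarrow> fps_sums v"
    unfolding u_def v_def
    by (intro fps_sums_tendsto fps_mult_power_nth_eq_0 c0 d0; assumption)+
  have "E * C = E * ((1 - Q) * fps_sums u + (Q - c)) + (1 - Q) * (fps_sums v - 1)"
  proof (rule LIMSEQ_unique)
    show "(\<lambda>J. E * (\<Sum>i\<le>Suc J. f i)) \<longlonglongrightarrow> E * C"
      by (intro tendsto_mult_fps tendsto_const LIMSEQ_Suc[OF lim_f])
    show "(\<lambda>J. E * (\<Sum>i\<le>Suc J. f i)) \<longlonglongrightarrow> E * ((1 - Q) * fps_sums u + (Q - c)) + (1 - Q) * (fps_sums v - 1)"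
      unfolding partial
      by (intro tendsto_add_fps tendsto_mult_fps tendsto_diff_fps tendsto_const LIMSEQ_Suc[OF lim_u] LIMSEQ_Suc[OF lim_v])
  qed
  moreover have "E * fps_sums u = 1"
  proof -
    have "E * fps_sums u = qinf (0 * c) Q"
      unfolding E_def u_def by (rule q_binomial_theorem[OF Q0 c0])
    then show ?thesis by (simp add: qinf_def poch0 fps_eq_iff)
  qed
  ultimately have "E * C + E * (c - Q) = (1 - Q) * fps_sums v"
    by algebra
  then have EC: "E * (C + (c - Q)) = (1 - Q) * fps_sums v"
    by (simp add: distrib_left)
  have v: "qinf d Q * fps_sums v = qinf (c * d) Q"
    unfolding v_def by (rule q_binomial_theorem[OF Q0 d0])
  have "c * d = fps_const (x * inverse x) * (Q * Q)"
    by (simp add: c_def d_def mult_ac flip: fps_const_mult)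
  then have cd: "c * d = Q * Q" using x by simp
  have "(C + (c - Q)) * E * qinf d Q = E * (C + (c - Q)) * qinf d Q"
    by (simp only: mult_ac)
  also have "\<dots> = (1 - Q) * (qinf d Q * fps_sums v)"
    unfolding EC by (simp only: mult_ac)
  also have "\<dots> = qinf Q Q"
    unfolding v cd using qinf_shift[OF Q0, of Q] by simp
  finally show ?thesis
    by (simp add: C_def E_def c_def d_def algebra_simps)
qed

section \<open>Coefficients modulo 5\<close>

lemma gf_all_partitions:
  "gf (parts_wrt dominates) (\<lambda>xs. 4 * sum_list xs) (\<lambda>_. 1) * qinf (fps_X ^ 4) (fps_X ^ 4) = (1 :: 'a :: comm_ring_1 fps)"
proof -
  let ?P = "\<lambda>N. gf (parts_wrt_le dominates N) (\<lambda>xs. 4 * sum_list xs) (\<lambda>_. 1 :: 'a)"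
  have "?P N * qpoch (fps_X ^ 4) (fps_X ^ 4) N = 1" for N
  proof (induction N)
    case (Suc N)
    have "(1 - fps_const 1 * fps_X ^ (4 * Suc N)) * ?P (Suc N) = ?P N"
      by (rule gf_parts_wrt_le_Suc_repeat) auto
    then have "?P N = (1 - fps_X ^ 4 * (fps_X ^ 4) ^ N) * ?P (Suc N)"
      by (simp add: power_add power_mult)
    then show ?case
      using Suc by (simp only: qpoch_Suc mult_ac)
  qed (simp add: gf_parts_wrt_le_0)
  moreover have "(\<lambda>N. ?P N * qpoch (fps_X ^ 4) (fps_X ^ 4) N)
      \<longlonglongrightarrow> gf (parts_wrt dominates) (\<lambda>xs. 4 * sum_list xs) (\<lambda>_. 1) * qinf (fps_X ^ 4) (fps_X ^ 4)"
    by (intro tendsto_mult_fps gf_parts_wrt_le_tendsto qpoch_tendsto_qinf) simp_all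
  ultimately show ?thesis
    by (simp add: tendsto_const_iff)
qed

text \<open>With weight 1 on \<open>pi1\<close>, the splitting into \<open>pi1\<close> and
  \<open>pi2\<close> counts all partitions by srank; comparison with \<open>gf_half_srank\<close>
  cancels the product in q^4.\<close>

lemma gf_nonrep_even:
  fixes z :: "'a :: field"
  assumes z: "z \<noteq> 0"
  shows "gf nonrep_even sum_list (\<lambda>xs. z powi half_srank xs)
      * qinf (fps_const (inverse z) * fps_X\<^sup>2) (fps_X ^ 4) * qinf (fps_const z * fps_X\<^sup>2) (fps_X ^ 4)
    = qinf (- fps_X) (fps_X\<^sup>2)"
proof -
  let ?P = "gf (parts_wrt dominates) (\<lambda>xs. 4 * sum_list xs) (\<lambda>_. 1 :: 'a)"
  let ?N = "gf nonrep_even sum_list (\<lambda>xs. z powi half_srank xs)"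
  have "gf (parts_wrt dominates) sum_list (\<lambda>xs. z powi half_srank xs) = ?P * ?N"
    using gf_pi1_half_srank[of "\<lambda>_. 1" z] by simp
  then have "?P * ?N * qinf (fps_const (inverse z) * fps_X\<^sup>2) (fps_X ^ 4) * qinf (fps_const z * fps_X\<^sup>2) (fps_X ^ 4)
      * qinf (fps_X ^ 4) (fps_X ^ 4) = qinf (- fps_X) (fps_X\<^sup>2)"
    using gf_half_srank[OF z] by simp
  moreover have "?P * ?N * a * b * qinf (fps_X ^ 4) (fps_X ^ 4) = (?P * qinf (fps_X ^ 4) (fps_X ^ 4)) * (?N * a * b)" for a b
    by (simp only: mult_ac)
  ultimately show ?thesis
    by (simp add: gf_all_partitions)
qed

text \<open>Hence the crank of \<open>pi1\<close> is 0 wherever \<open>Psi\<close> is 1, and there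
  \<open>Psi\<close> changes the weight by the summand x - 1 times the srank weight.\<close>

lemma pi1_typeB:
  assumes "typeB xs"
  shows "pi1 xs = []"
proof (rule partition_eqI)
  show "pi1 xs \<in> parts_wrt dominates"
    unfolding pi1_eq by (rule of_counts_in_parts_wrt)
  fix k
  have "count_list xs (2 * k) \<le> 1"
  proof (cases "xs = [3, 1]")
    case True
    have "2 * k \<noteq> 1" "2 * k \<noteq> 3" by presburger+
    then show ?thesis using True by simp
  next
    case False
    then show ?thesis using assms unfolding typeB_def by simp
  qed
  then show "count_list (pi1 xs) k = count_list [] k"
    by (auto simp: count_list_pi1)
qed (simp add: parts_wrt_def)

definition stcrank_gf :: "complex \<Rightarrow> complex \<Rightarrow> complex fps" where
  "stcrank_gf x e = gf (parts_wrt dominates) sum_list (\<lambda>xs. x powi stcrank xs * e powi half_srank xs)"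

text \<open>The statistic \<^const>\<open>Psi\<close> adds exactly the term by which the generating function of the
  combinatorial crank misses the infinite product.\<close>

lemma stcrank_gf_eq:
  assumes x: "x \<noteq> 0"
  shows "stcrank_gf x e = (gf (parts_wrt dominates) (\<lambda>xs. 4 * sum_list xs) (\<lambda>xs. x powi crank xs)
      + (fps_const x - 1) * fps_X ^ 4) * gf nonrep_even sum_list (\<lambda>xs. (x * e) powi half_srank xs)"
proof -
  let ?P = "parts_wrt dominates" and ?h = "\<lambda>xs. (x * e) powi half_srank xs"
  have wt: "x powi stcrank xs * e powi half_srank xs
      = x powi crank (pi1 xs) * ?h xs + (if typeB xs then (x - 1) * ?h xs else 0)" if "xs \<in> ?P" for xs
  proof -
    have "srank xs div 2 = half_srank xs"
      using srank_eq[of xs] that by (simp add: is_partition_iff)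
    then have st: "stcrank xs = crank (pi1 xs) + half_srank xs + (if typeB xs then 1 else 0)"
      by (simp add: stcrank_def Psi_def)
    show ?thesis
    proof (cases "typeB xs")
      case True
      then have "crank (pi1 xs) = 0" by (simp add: pi1_typeB crank_def largest_def)
      then show ?thesis
        using st True x by (simp add: power_int_add power_int_mult_distrib algebra_simps)
    next
      case False
      then show ?thesis
        using st x by (simp add: power_int_add power_int_mult_distrib)
    qed
  qed
  have fin: "finite {xs. xs \<in> ?P \<and> sum_list xs = n}" for n
    using finite_fibre[OF parts_wrt_pos(1)[of dominates], of 1 n] by simp
  have "stcrank_gf x e = gf ?P sum_list (\<lambda>xs. x powi crank (pi1 xs) * ?h xs + (if typeB xs then (x - 1) * ?h xs else 0))"
    unfolding stcrank_gf_def by (rule gf_cong) (auto simp: wt)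
  also have "\<dots> = gf ?P sum_list (\<lambda>xs. x powi crank (pi1 xs) * ?h xs)
      + gf ?P sum_list (\<lambda>xs. if typeB xs then (x - 1) * ?h xs else 0)"
    by (simp add: fps_eq_iff gf_nth sum.distrib)
  also have "gf ?P sum_list (\<lambda>xs. if typeB xs then (x - 1) * ?h xs else 0)
      = gf {xs \<in> ?P. typeB xs} sum_list (\<lambda>xs. (x - 1) * ?h xs)"
    by (rule gf_restrict[OF fin, symmetric])
  also have "\<dots> = fps_const (x - 1) * gf {xs \<in> ?P. typeB xs} sum_list ?h"
    by (simp add: fps_eq_iff gf_nth sum_distrib_left)
  finally show ?thesis
    unfolding gf_typeB gf_pi1_half_srank[of "\<lambda>xs. x powi crank xs" "x * e"]
    by (simp add: distrib_right mult.assoc flip: fps_const_sub)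
qed

lemma stcrank_gf_product:
  assumes x: "x \<noteq> 0" and e: "e\<^sup>2 = 1"
  defines "Q \<equiv> fps_const e * fps_X\<^sup>2"
  shows "stcrank_gf x e * qinf (fps_const x * Q) Q * qinf (fps_const (inverse x) * Q) Q
    = qinf (fps_X ^ 4) (fps_X ^ 4) * qinf (- fps_X) (fps_X\<^sup>2)"
proof -
  define C where "C = gf (parts_wrt dominates) (\<lambda>xs. 4 * sum_list xs) (\<lambda>xs. x powi crank xs) + (fps_const x - 1) * fps_X ^ 4"
  define N where "N = gf nonrep_even sum_list (\<lambda>xs. (x * e) powi half_srank xs)"
  have Q0: "Q $ 0 = 0" by (simp add: Q_def)
  have Q2: "Q\<^sup>2 = fps_X ^ 4"
    using e by (simp add: Q_def power_mult_distrib fps_const_power flip: power_mult)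
  have e0: "e \<noteq> 0" using e by auto
  have ie: "inverse e = e" using e e0 by (simp add: power2_eq_square inverse_unique)
  \<comment> \<open>As Q^2 = q^4, the factors of even index belong to the srank product and those of
    odd index to the crank product.\<close>
  have split: "qinf (fps_const y * Q) Q = qinf (fps_const (y * e) * fps_X\<^sup>2) (fps_X ^ 4) * qinf (fps_const y * fps_X ^ 4) (fps_X ^ 4)" for y
    using qinf_even_odd[OF Q0, of "fps_const y * Q"]
    by (simp add: Q2[symmetric] power2_eq_square mult.assoc) (simp add: Q_def power2_eq_square mult.assoc flip: fps_const_mult)
  have "stcrank_gf x e * qinf (fps_const x * Q) Q * qinf (fps_const (inverse x) * Q) Q
      = (C * qinf (fps_const x * fps_X ^ 4) (fps_X ^ 4) * qinf (fps_const (inverse x) * fps_X ^ 4) (fps_X ^ 4))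
        * (N * qinf (fps_const (inverse x * e) * fps_X\<^sup>2) (fps_X ^ 4) * qinf (fps_const (x * e) * fps_X\<^sup>2) (fps_X ^ 4))"
    unfolding split stcrank_gf_eq[OF x] C_def N_def by (simp only: mult_ac)
  moreover have "C * qinf (fps_const x * fps_X ^ 4) (fps_X ^ 4) * qinf (fps_const (inverse x) * fps_X ^ 4) (fps_X ^ 4)
      = qinf (fps_X ^ 4) (fps_X ^ 4)"
    unfolding C_def by (rule gf_crank) (simp_all add: x)
  moreover have "N * qinf (fps_const (inverse x * e) * fps_X\<^sup>2) (fps_X ^ 4) * qinf (fps_const (x * e) * fps_X\<^sup>2) (fps_X ^ 4)
      = qinf (- fps_X) (fps_X\<^sup>2)"
    using gf_nonrep_even[of "x * e"] x e0 by (simp add: N_def ie)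
  ultimately show ?thesis by simp
qed

section \<open>Supports of the theta series modulo 5\<close>

definition fps_supp_mod :: "nat \<Rightarrow> 'a :: zero fps \<Rightarrow> nat set \<Rightarrow> bool" where
  "fps_supp_mod m f S \<longleftrightarrow> (\<forall>n. f $ n \<noteq> 0 \<longrightarrow> n mod m \<in> S)"

lemma fps_supp_mod_mult:
  fixes f g :: "'a :: comm_ring_1 fps"
  assumes "fps_supp_mod m f S" "fps_supp_mod m g T"
  shows "fps_supp_mod m (f * g) {(s + t) mod m |s t. s \<in> S \<and> t \<in> T}"
  unfolding fps_supp_mod_def
proof (intro allI impI)
  fix n assume "(f * g) $ n \<noteq> 0"
  then obtain i where i: "i \<le> n" "f $ i * g $ (n - i) \<noteq> 0"
    unfolding fps_mult_nth by (metis (no_types, lifting) atLeastAtMost_iff sum.neutral)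
  then have "i mod m \<in> S" "(n - i) mod m \<in> T"
    using assms unfolding fps_supp_mod_def by (metis mult_zero_left, metis mult_zero_right)
  moreover have "n mod m = (i mod m + (n - i) mod m) mod m"
    using i(1) by (simp add: mod_add_eq)
  ultimately show "n mod m \<in> {(s + t) mod m |s t. s \<in> S \<and> t \<in> T}" by blast
qed

lemma fps_supp_mod_sum:
  assumes "\<And>n. f $ n = (\<Sum>m\<in>M n. g m $ n)" "\<And>m. fps_supp_mod k (g m) S"
  shows "fps_supp_mod k f S"
  unfolding fps_supp_mod_def
proof (intro allI impI)
  fix n assume "f $ n \<noteq> 0"
  then obtain m where "g m $ n \<noteq> 0"
    unfolding assms(1) by (meson sum.neutral)
  then show "n mod k \<in> S"
    using assms(2) by (simp add: fps_supp_mod_def)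
qed

lemma fps_supp_mod_monom: "(c \<noteq> 0 \<Longrightarrow> n mod k \<in> S) \<Longrightarrow> fps_supp_mod k (fps_const c * fps_X ^ n) S"
  by (auto simp: fps_supp_mod_def)

lemma fps_supp_mod_add:
  fixes f g :: "'a :: comm_ring_1 fps"
  shows "fps_supp_mod k f S \<Longrightarrow> fps_supp_mod k g S \<Longrightarrow> fps_supp_mod k (f + g) S"
  unfolding fps_supp_mod_def by (metis add.right_neutral fps_add_nth)

lemma mod_5_cases: "m mod 5 \<in> {0, 1, 2, 3, 4 :: nat}"
  using mod_less_divisor[of 5 m] by auto

text \<open>Triple product with base q^4, a = q and b = q^3: the exponents 2m^2 + m and 2k^2 - k are
  triangular numbers, which are 0, 1 or 3 modulo 5.\<close>

lemma fps_supp_mod_psi: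
  "fps_supp_mod 5 (qinf (fps_X ^ 4) (fps_X ^ 4) * qinf (- fps_X) (fps_X\<^sup>2) :: complex fps) {0, 1, 3}"
proof -
  let ?q = "fps_X ^ 4 :: complex fps" and ?a = "fps_X :: complex fps" and ?b = "fps_X ^ 3 :: complex fps"
  have "qinf (- fps_X) (fps_X\<^sup>2) = qinf (- ?a) ?q * qinf (- ?b) ?q"
    using qinf_even_odd[of "fps_X\<^sup>2" "- ?a"] by (simp flip: power_mult) (simp add: power2_eq_square power3_eq_cube mult.assoc)
  moreover have "?q $ 0 = 0" "?q \<noteq> 0" "?a * ?b = ?q"
    by (simp_all flip: power_Suc)
  ultimately have jtp: "(qinf ?q ?q * qinf (- fps_X) (fps_X\<^sup>2)) $ n
    = (\<Sum>m\<le>Suc n. (jtp_term ?q ?b m + jtp_term ?q ?a (Suc m)) $ n)" for n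
    using jacobi_triple_product[of ?q ?a ?b n] by simp
  have "fps_supp_mod 5 (jtp_term ?q ?b m + jtp_term ?q ?a (Suc m)) {0, 1, 3}" for m
  proof (rule fps_supp_mod_add)
    have "3 * m + 4 * (m choose 2) = 2 * m * m + m"
      using two_times_choose_2[of m] by simp
    moreover have "(2 * m * m + m) mod 5 = (2 * (m mod 5) * (m mod 5) + m mod 5) mod 5"
      by (intro mod_add_cong mod_mult_cong) simp_all
    ultimately have e: "(3 * m + 4 * (m choose 2)) mod 5 = (2 * (m mod 5) * (m mod 5) + m mod 5) mod 5"
      by (simp only:)
    have "(3 * m + 4 * (m choose 2)) mod 5 \<in> {0, 1, 3}"
      unfolding e using mod_5_cases[of m] by auto
    then show "fps_supp_mod 5 (jtp_term ?q ?b m) {0, 1, 3}"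
      using fps_supp_mod_monom[of 1 "3 * m + 4 * (m choose 2)" 5 "{0, 1, 3}"]
      by (simp add: jtp_term_def power_add power_mult)
  next
    define k where "k = Suc m"
    have "k + 4 * (k choose 2) + k = 2 * k * k"
      using two_times_choose_2[of k] by simp
    \<comment> \<open>Adding 5k replaces 2k^2 - k by 2k^2 + 4k and so avoids subtraction.\<close>
    then have "(k + 4 * (k choose 2)) + 5 * k = 2 * k * k + 4 * k" by simp
    then have "(k + 4 * (k choose 2)) mod 5 = (2 * k * k + 4 * k) mod 5"
      by (metis mod_mult_self2)
    moreover have "(2 * k * k + 4 * k) mod 5 = (2 * (k mod 5) * (k mod 5) + 4 * (k mod 5)) mod 5"
      by (intro mod_add_cong mod_mult_cong) simp_all
    ultimately have "(k + 4 * (k choose 2)) mod 5 \<in> {0, 1, 3}"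
      using mod_5_cases[of k] by auto
    then show "fps_supp_mod 5 (jtp_term ?q ?a (Suc m)) {0, 1, 3}"
      using fps_supp_mod_monom[of 1 "k + 4 * (k choose 2)" 5 "{0, 1, 3}"]
      unfolding k_def[symmetric] by (simp add: jtp_term_def power_add power_mult)
  qed
  then show ?thesis
    by (intro fps_supp_mod_sum[OF jtp])
qed

text \<open>The \<open>m\<close>-th term on the side of \<open>b\<close> and the
  \<open>Suc m\<close>-th on the side of \<open>a\<close> share the exponent m(m+1), which is 1
  modulo 5 only for m = 2 modulo 5. There the coefficient, x^(3m) - x^(2m+2) up to sign and a power
  of \<open>e\<close>, vanishes because x^5 = 1.\<close>

lemma fps_supp_mod_theta:
  fixes x e :: complex
  assumes x: "x ^ 5 = 1" and e: "e \<noteq> 0"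
  defines "Q \<equiv> fps_const e * fps_X\<^sup>2"
  shows "fps_supp_mod 5 (qinf Q Q * (qinf (fps_const (x\<^sup>2)) Q * qinf (fps_const (x ^ 3) * Q) Q)) {0, 2}"
proof -
  \<comment> \<open>The triple product needs \<open>?a * ?b = Q\<close>, so one factor starts at the
    constant x^2 and not at x^2 Q; this later costs a factor 1 - x^2.\<close>
  let ?a = "- fps_const (x\<^sup>2)" and ?b = "- (fps_const (x ^ 3) * Q)"
  have Q: "Q $ 0 = 0" "Q \<noteq> 0" using e by (simp_all add: Q_def)
  have "?a * ?b = fps_const (x\<^sup>2 * x ^ 3) * Q"
    by (simp only: minus_mult_minus mult.assoc[symmetric] fps_const_mult)
  also have "x\<^sup>2 * x ^ 3 = 1" using x by (simp flip: power_add)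
  finally have ab: "?a * ?b = Q" by simp
  have jtp: "(qinf Q Q * (qinf (fps_const (x\<^sup>2)) Q * qinf (fps_const (x ^ 3) * Q) Q)) $ n
    = (\<Sum>m\<le>Suc n. (jtp_term Q ?b m + jtp_term Q ?a (Suc m)) $ n)" for n
    using jacobi_triple_product[OF Q ab, of n] by simp
  have "fps_supp_mod 5 (jtp_term Q ?b m + jtp_term Q ?a (Suc m)) {0, 2}" for m
  proof -
    define T where "T = Suc m choose 2"
    have T: "T = m + (m choose 2)" by (simp add: T_def Suc_choose_2)
    have "2 * T = m * m + m"
      using two_times_choose_2[of m] by (simp add: T)
    moreover have "(m * m + m) mod 5 = ((m mod 5) * (m mod 5) + m mod 5) mod 5"
      by (intro mod_add_cong mod_mult_cong) simp_all
    ultimately have T5: "m mod 5 \<noteq> 2 \<Longrightarrow> (2 * T) mod 5 \<in> {0, 2}"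
      using mod_5_cases[of m] by auto
    define c where "c = ((- (x ^ 3)) ^ m + (- (x\<^sup>2)) ^ Suc m) * e ^ T"
    have c0: "c = 0" if "m mod 5 = 2"
    proof -
      define k where "k = m div 5"
      have m: "m = 5 * k + 2"
        using div_mult_mod_eq[of m 5] that unfolding k_def by linarith
      have p: "(x ^ 3) ^ m = x" "(x\<^sup>2) ^ Suc m = x"
      proof -
        have e: "3 * m = 5 * (3 * k + 1) + 1" "2 * Suc m = 5 * (2 * k + 1) + 1"
          using m by simp_all
        have "(x ^ 3) ^ m = (x ^ 5) ^ (3 * k + 1) * x" "(x\<^sup>2) ^ Suc m = (x ^ 5) ^ (2 * k + 1) * x"
          unfolding power_mult[symmetric] e by (simp_all only: power_add power_one_right)
        then show "(x ^ 3) ^ m = x" "(x\<^sup>2) ^ Suc m = x" by (simp_all add: x)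
      qed
      have "(- (x ^ 3)) ^ m = (- 1) ^ m * x" "(- (x\<^sup>2)) ^ Suc m = (- 1) ^ Suc m * x"
        using p power_minus[of "x ^ 3" m] power_minus[of "x\<^sup>2" "Suc m"] by simp_all
      then show ?thesis by (simp add: c_def)
    qed
    have "jtp_term Q ?b m = fps_const ((- (x ^ 3)) ^ m) * Q ^ T"
    proof -
      have "?b ^ m = fps_const ((- (x ^ 3)) ^ m) * Q ^ m"
        by (simp add: power_mult_distrib flip: fps_const_power fps_const_neg mult_minus_left)
      then show ?thesis by (simp add: jtp_term_def T power_add mult.assoc)
    qed
    moreover have "jtp_term Q ?a (Suc m) = fps_const ((- (x\<^sup>2)) ^ Suc m) * Q ^ T"
      by (simp only: jtp_term_def T_def[symmetric] fps_const_power fps_const_neg)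
    moreover have "Q ^ T = fps_const (e ^ T) * fps_X ^ (2 * T)"
      by (simp add: Q_def power_mult_distrib power_mult fps_const_power)
    ultimately have "jtp_term Q ?b m + jtp_term Q ?a (Suc m) = fps_const c * fps_X ^ (2 * T)"
      by (simp only: c_def distrib_right mult.assoc fps_const_add[symmetric] fps_const_mult[symmetric])
    moreover have "fps_supp_mod 5 (fps_const c * fps_X ^ (2 * T)) {0, 2}"
      using T5 c0 by (intro fps_supp_mod_monom) auto
    ultimately show ?thesis by simp
  qed
  then show ?thesis
    by (intro fps_supp_mod_sum[OF jtp])
qed

lemma fps_supp_mod_fifth_powers:
  fixes e :: complex
  defines "Q \<equiv> fps_const e * fps_X\<^sup>2"
  shows "fps_supp_mod 5 (qinf (Q ^ 5) (Q ^ 5)) {0}"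
proof -
  have fac: "fps_supp_mod 5 (1 - Q ^ 5 * (Q ^ 5) ^ k) {0}" for k
  proof -
    have "Q ^ 5 * (Q ^ 5) ^ k = Q ^ (5 * Suc k)"
      by (simp add: power_add power_mult)
    also have "\<dots> = fps_const (e ^ (5 * Suc k)) * fps_X ^ (2 * (5 * Suc k))"
      unfolding Q_def power_mult_distrib fps_const_power power_mult[symmetric] ..
    finally have "1 - Q ^ 5 * (Q ^ 5) ^ k = fps_const 1 * fps_X ^ 0 + fps_const (- (e ^ (5 * Suc k))) * fps_X ^ (2 * (5 * Suc k))"
      by (simp only: fps_const_1_eq_1 power_0 mult_1_right fps_const_neg[symmetric] mult_minus_left diff_conv_add_uminus)
    moreover have "(2 * (5 * Suc k)) mod 5 = 0"
      by presburger
    ultimately show ?thesis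
      by (simp only:) (intro fps_supp_mod_add fps_supp_mod_monom; simp)
  qed
  have "fps_supp_mod 5 (qpoch (Q ^ 5) (Q ^ 5) N) {0}" for N
  proof (induction N)
    case 0
    then show ?case by (auto simp: fps_supp_mod_def)
  next
    case (Suc N)
    then show ?case
      using fps_supp_mod_mult[OF Suc fac[of N]] by (simp add: qpoch_Suc)
  qed
  then show ?thesis
    by (auto simp: fps_supp_mod_def qinf_def)
qed

text \<open>Residues from {0, 1, 3} and {0, 2} never add up to 4 modulo 5, so
  \<open>stcrank_gf x e\<close> times G has no coefficients there. G has constant term 1 and only
  exponents divisible by 5, hence can be removed inside one residue class.\<close>

theorem stcrank_gf_nth_eq_0:
  assumes x: "x ^ 5 = 1" "x \<noteq> 1" and e: "e\<^sup>2 = 1" and n: "n mod 5 = 4"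
  shows "stcrank_gf x e $ n = 0"
proof -
  define Q :: "complex fps" where "Q = fps_const e * fps_X\<^sup>2"
  define G where "G = qinf (Q ^ 5) (Q ^ 5)"
  define psi where "psi = (qinf (fps_X ^ 4) (fps_X ^ 4) * qinf (- fps_X) (fps_X\<^sup>2) :: complex fps)"
  define theta where "theta = qinf Q Q * (qinf (fps_const (x\<^sup>2)) Q * qinf (fps_const (x ^ 3) * Q) Q)"
  define c where "c = fps_const x"
  have x0: "x \<noteq> 0" using x by auto
  have "x * x ^ 4 = 1" using x(1) by (simp flip: power_Suc)
  then have ix: "inverse x = x ^ 4" by (rule inverse_unique)
  have e0: "e \<noteq> 0" using e by auto
  have Q0: "Q $ 0 = 0" by (simp add: Q_def)
  have "(x - 1) * (1 + x + x ^ 2 + x ^ 3 + x ^ 4) = x ^ 5 - 1"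
    by (simp add: algebra_simps eval_nat_numeral)
  then have s: "1 + x + x ^ 2 + x ^ 3 + x ^ 4 = 0"
    using x by simp
  have "1 + c + c ^ 2 + c ^ 3 + c ^ 4 = fps_const (1 + x + x ^ 2 + x ^ 3 + x ^ 4)"
    by (simp add: c_def fps_const_power flip: fps_const_add)
  then have roots: "1 + c + c ^ 2 + c ^ 3 + c ^ 4 = 0" unfolding s by simp
  have F: "stcrank_gf x e * qinf (c * Q) Q * qinf (c ^ 4 * Q) Q = psi"
    using stcrank_gf_product[OF x0 e] unfolding ix Q_def c_def psi_def fps_const_power .
  have th: "theta = qinf Q Q * ((1 - c\<^sup>2) * qinf (c ^ 2 * Q) Q * qinf (c ^ 3 * Q) Q)"
    using qinf_shift[OF Q0, of "c\<^sup>2"] by (simp add: theta_def c_def fps_const_power)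
  have "psi * theta = (1 - c\<^sup>2) * (stcrank_gf x e * (qinf Q Q * qinf (c * Q) Q * qinf (c ^ 4 * Q) Q * qinf (c ^ 2 * Q) Q * qinf (c ^ 3 * Q) Q))"
    unfolding F[symmetric] th by (simp only: mult_ac)
  also have "\<dots> = (1 - c\<^sup>2) * (stcrank_gf x e * G)"
    unfolding qinf_fifth_roots[OF Q0 roots] G_def ..
  also have "1 - c\<^sup>2 = fps_const (1 - x\<^sup>2)"
    by (simp add: c_def fps_const_power flip: fps_const_sub)
  finally have eq: "psi * theta = fps_const (1 - x\<^sup>2) * (stcrank_gf x e * G)" .
  have x2: "1 - x\<^sup>2 \<noteq> 0"
  proof
    assume "1 - x\<^sup>2 = 0"
    then have "x\<^sup>2 = 1" by simp
    then have "x ^ 5 = x" by (simp add: eval_nat_numeral)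
    then show False using x by simp
  qed
  have "fps_supp_mod 5 (psi * theta) {(s + t) mod 5 |s t. s \<in> {0, 1, 3} \<and> t \<in> {0, 2}}"
    using fps_supp_mod_mult[OF fps_supp_mod_psi fps_supp_mod_theta[OF x(1) e0]]
    unfolding psi_def theta_def Q_def .
  then have "(psi * theta) $ m = 0" if "m mod 5 = 4" for m
    using that by (auto simp: fps_supp_mod_def)
  then have FG: "(stcrank_gf x e * G) $ m = 0" if "m mod 5 = 4" for m
    using that x2 by (simp add: eq)
  have G: "fps_supp_mod 5 G {0}"
    unfolding G_def Q_def by (rule fps_supp_mod_fifth_powers)
  have G0: "G $ 0 = 1"
    using Q0 by (simp add: G_def fps_power_zeroth)
  from n show ?thesis
  proof (induction n rule: less_induct)
    case (less n)
    \<comment> \<open>Either \<open>i\<close> lies in the residue class 4 and the induction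
      hypothesis applies, or \<open>n - i\<close> is not a multiple of 5.\<close>
    have "stcrank_gf x e $ i * G $ (n - i) = 0" if "i < n" for i
    proof (cases "i mod 5 = 4")
      case True
      then show ?thesis using less.IH that by simp
    next
      case False
      have "G $ (n - i) = 0"
      proof (rule ccontr)
        assume "G $ (n - i) \<noteq> 0"
        then have "(n - i) mod 5 = 0" using G by (auto simp: fps_supp_mod_def)
        then have "i mod 5 = n mod 5" using that by (metis less_imp_le mod_eq_dvd_iff_nat mod_0_imp_dvd)
        then show False using False less.prems by simp
      qed
      then show ?thesis by simp
    qed
    then have "(stcrank_gf x e * G) $ n = stcrank_gf x e $ n * G $ 0"
      unfolding fps_mult_nth by (subst sum.remove[of _ n]) (auto intro!: sum.neutral simp del: mult_eq_0_iff)
    then show ?case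
      using FG[OF less.prems] G0 by simp
  qed
qed

section \<open>From vanishing coefficients to equal classes\<close>

lemma partitions_eq: "partitions n = {xs. xs \<in> parts_wrt dominates \<and> sum_list xs = n}"
  by (auto simp: partitions_def is_partition_iff)

lemma finite_partitions: "finite (partitions n)"
  using finite_fibre[OF parts_wrt_pos(1)[of dominates], of 1 n] by (simp add: partitions_eq)

text \<open>The sums for both signs vanish; half their sum or difference selects even or odd half
  srank, that is, srank 0 or 2 modulo 4.\<close>

lemma sum_stcrank_srank_class:
  assumes x: "x ^ 5 = 1" "x \<noteq> 1" and i: "i \<in> {0, 2}" and n: "n mod 5 = 4"
  shows "(\<Sum>xs | xs \<in> partitions n \<and> srank xs mod 4 = int i. x powi stcrank xs) = (0 :: complex)"
proof -
  have F: "(\<Sum>xs\<in>partitions n. x powi stcrank xs * e powi half_srank xs) = 0" if "e\<^sup>2 = 1" for e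
    using stcrank_gf_nth_eq_0[OF x that n] by (simp add: stcrank_gf_def gf_nth partitions_eq)
  define s :: complex where "s = (if i = 0 then 1 else - 1)"
  have "(if srank xs mod 4 = int i then 2 else 0) = 1 + s * (- 1) powi half_srank xs" if "xs \<in> partitions n" for xs
  proof -
    have sr: "srank xs = 2 * half_srank xs"
      using that srank_eq by (simp add: partitions_def)
    have "srank xs mod 4 = (if even (half_srank xs) then 0 else 2)"
      unfolding sr by presburger
    then show ?thesis
      using i by (auto simp: s_def power_int_minus_left)
  qed
  then have "(\<Sum>xs\<in>partitions n. x powi stcrank xs * (if srank xs mod 4 = int i then 2 else 0))
      = (\<Sum>xs\<in>partitions n. x powi stcrank xs * 1 powi half_srank xs + s * (x powi stcrank xs * (- 1) powi half_srank xs))"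
    by (intro sum.cong) (auto simp: algebra_simps)
  also have "\<dots> = 0"
    using F[of 1] F[of "- 1"] by (simp add: sum.distrib flip: sum_distrib_left)
  finally have "(\<Sum>xs\<in>partitions n. if srank xs mod 4 = int i then 2 * x powi stcrank xs else 0) = 0"
    by (simp add: if_distrib mult.commute cong: if_cong)
  then have "2 * (\<Sum>xs | xs \<in> partitions n \<and> srank xs mod 4 = int i. x powi stcrank xs) = 0"
    using sum.inter_filter[OF finite_partitions[of n], of "\<lambda>xs. 2 * x powi stcrank xs" "\<lambda>xs. srank xs mod 4 = int i"]
    by (simp add: sum_distrib_left)
  then show ?thesis by simp
qed

text \<open>Fourier inversion modulo 5: the indicator of a residue class is an average of
  characters, and all nontrivial ones contribute 0 by assumption.\<close>

lemma equidistributed_mod_5: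
  fixes f :: "'b \<Rightarrow> int"
  assumes S: "finite S" and sum: "\<And>x :: complex. x ^ 5 = 1 \<Longrightarrow> x \<noteq> 1 \<Longrightarrow> (\<Sum>s\<in>S. x powi f s) = 0"
    and k: "k \<in> {0..<5}"
  shows "5 * card {s \<in> S. f s mod 5 = k} = card S"
proof -
  have "\<exists>w :: complex. w ^ 5 = 1 \<and> w \<noteq> 1"
  proof (rule ccontr)
    assume "\<nexists>w :: complex. w ^ 5 = 1 \<and> w \<noteq> 1"
    then have "{w :: complex. w ^ 5 = 1} \<subseteq> {1}" by auto
    then have "card {w :: complex. w ^ 5 = 1} \<le> card {1 :: complex}"
      by (intro card_mono) auto
    then show False using card_roots_unity_eq[of 5] by simp
  qed
  then obtain w :: complex where w: "w ^ 5 = 1" "w \<noteq> 1" by blast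
  have w0: "w \<noteq> 0" using w by auto
  have wj: "w ^ j \<noteq> 1" if "j \<in> {1, 2, 3, 4}" for j
  proof
    assume j: "w ^ j = 1"
    have "w = 1"
    proof -
      \<comment> \<open>For j = 2, 3, 4 a multiple of j is 1 away from 5, so w^j = 1 and w^5 = 1
        give w = 1.\<close>
      have eqs: "w ^ 5 = w * (w ^ 2) ^ 2" "w * w ^ 5 = (w ^ 3) ^ 2" "w ^ 5 = w * w ^ 4"
        by (simp_all add: eval_nat_numeral)
      consider "j = 1" | "j = 2" | "j = 3" | "j = 4" using \<open>j \<in> _\<close> by auto
      then show ?thesis
      proof cases
        case 1
        then show ?thesis using j by simp
      next
        case 2
        then show ?thesis using j eqs(1) w(1) by (metis mult_1_right power_one)
      next
        case 3
        then show ?thesis using j eqs(2) w(1) by (metis mult_1_right power_one)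
      next
        case 4
        then show ?thesis using j eqs(3) w(1) by (metis mult_1_right)
      qed
    qed
    then show False using w(2) by simp
  qed
  have w5: "(w powi m) ^ 5 = 1" for m
    using w(1) by (metis power_int_mult power_int_numeral mult.commute power_int_1_left)
  have pm: "w powi m = w ^ nat (m mod 5)" for m
  proof -
    have "w powi m = w powi (5 * (m div 5) + m mod 5)" by simp
    also have "\<dots> = (w powi 5) powi (m div 5) * w powi (m mod 5)"
      using w0 by (simp only: power_int_add power_int_mult simp_thms)
    also have "w powi 5 = 1" using w(1) by (simp only: power_int_numeral)
    finally show ?thesis by (simp add: power_int_def)
  qed
  have orth: "(\<Sum>j<5. (w powi (f s - k)) ^ j) = (if f s mod 5 = k then 5 else 0)" for s
  proof (cases "f s mod 5 = k")
    case True
    then have "(f s - k) mod 5 = 0" by (simp add: mod_eq_dvd_iff[symmetric] flip: True)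
    then show ?thesis using True by (simp add: pm)
  next
    case False
    then have "(f s - k) mod 5 \<noteq> 0"
      using k mod_eq_dvd_iff[of "f s" 5 k] by auto
    then have "nat ((f s - k) mod 5) \<in> {1, 2, 3, 4}"
      using pos_mod_bound[of 5 "f s - k"] pos_mod_sign[of 5 "f s - k"] by auto
    then have "w powi (f s - k) \<noteq> 1" unfolding pm by (rule wj)
    then show ?thesis
      using False w5[of "f s - k"] by (simp add: sum_gp_strict)
  qed
  have zero: "(\<Sum>s\<in>S. (w powi (f s - k)) ^ j) = 0" if "j \<in> {1, 2, 3, 4}" for j
  proof -
    have "(w ^ j) ^ 5 = 1" using w(1) by (metis mult.commute power_mult power_one)
    then have "(\<Sum>s\<in>S. (w ^ j) powi f s) = 0" using wj[OF that] by (rule sum)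
    moreover have "(w powi (f s - k)) ^ j = (w ^ j) powi f s * inverse ((w ^ j) powi k)" for s
    proof -
      have "(w powi (f s - k)) ^ j = (w ^ j) powi (f s - k)"
        by (metis mult.commute power_int_mult power_int_of_nat)
      then show ?thesis using w0 by (simp add: power_int_diff divide_inverse)
    qed
    ultimately show ?thesis by (simp flip: sum_distrib_right)
  qed
  have "of_nat (5 * card {s \<in> S. f s mod 5 = k}) = (\<Sum>s\<in>S. if f s mod 5 = k then 5 else 0 :: complex)"
    using sum.inter_filter[OF S, of "\<lambda>_. 5 :: complex" "\<lambda>s. f s mod 5 = k"] by (simp add: mult.commute)
  also have "\<dots> = (\<Sum>j<5. \<Sum>s\<in>S. (w powi (f s - k)) ^ j)"
    unfolding orth[symmetric] by (rule sum.swap)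
  also have "{..<5} = insert 0 {1, 2, 3, 4 :: nat}" by auto
  also have "(\<Sum>j\<in>insert 0 {1, 2, 3, 4}. \<Sum>s\<in>S. (w powi (f s - k)) ^ j)
      = (\<Sum>s\<in>S. (w powi (f s - k)) ^ 0) + (\<Sum>j\<in>{1, 2, 3, 4}. \<Sum>s\<in>S. (w powi (f s - k)) ^ j)"
    by (rule sum.insert) auto
  also have "(\<Sum>j\<in>{1, 2, 3, 4}. \<Sum>s\<in>S. (w powi (f s - k)) ^ j) = 0"
    by (intro sum.neutral ballI zero)
  finally have "of_nat (5 * card {s \<in> S. f s mod 5 = k}) = (of_nat (card S) :: complex)"
    by simp
  then show ?thesis
    by (simp only: of_nat_eq_iff)
qed

theorem theorem1:
  fixes n i k :: nat
  assumes "i \<in> {0, 2}" and "k \<in> {0, 1, 2, 3, 4}"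
  shows "real (card {xs \<in> partitions (5 * n + 4).
                 srank xs mod 4 = int i \<and> stcrank xs mod 5 = int k})
         = real (p_srank i (5 * n + 4)) / 5"
proof -
  define S where "S = {xs. xs \<in> partitions (5 * n + 4) \<and> srank xs mod 4 = int i}"
  have "5 * card {xs \<in> S. stcrank xs mod 5 = int k} = card S"
  proof (rule equidistributed_mod_5)
    show "finite S"
      unfolding S_def using finite_partitions by simp
    show "(\<Sum>xs\<in>S. x powi stcrank xs) = 0" if "x ^ 5 = 1" "x \<noteq> 1" for x :: complex
      unfolding S_def by (rule sum_stcrank_srank_class[OF that assms(1)]) simp
    show "int k \<in> {0..<5}"
      using assms(2) by auto
  qed
  moreover have "{xs \<in> S. stcrank xs mod 5 = int k}
      = {xs \<in> partitions (5 * n + 4). srank xs mod 4 = int i \<and> stcrank xs mod 5 = int k}"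
    by (auto simp: S_def)
  moreover have "card S = p_srank i (5 * n + 4)"
    by (simp add: S_def p_srank_def)
  ultimately show ?thesis
    by (simp add: field_simps flip: of_nat_mult)
qed

end
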